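(* Let $H$ be a Hilbert $C^*$-module and $Q\in\mathcal{L}(H)$ an idempotent. Then $$s(Q)=m(Q)+(I-Q^* )|Q^*|^\dagger+|Q^*|^\dagger(I-Q).$$
   Context: $H$ is a Hilbert module over a $C^*$-algebra, $\mathcal{L}(H)$ the adjointable operators. For $T\in\mathcal{L}(H)$, $|T|=(T^*T)^{1/2}$, and $T^\dagger$ is the Moore–Penrose inverse (unique $X$ with $TXT=T$, $XTX=X$, $(TX)^*=TX$, $(XT)^*=XT$; exists iff $\mathcal{R}(T)$ closed). For an idempotent $Q$, the matched projection is $m(Q)=\tfrac12(|Q^*|+Q^* )|Q^*|^\dagger(|Q^*|+I)^{-1}(|Q^*|+Q)$, and the supplementary projection is $s(Q)=m(2P_{\mathcal{R}(Q)}-Q)$, where $P_{\mathcal{R}(Q)}$ is the projection onto $\mathcal{R}(Q)$. *)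

theory Defs
  imports "HOL-Analysis.Analysis"
begin

class complex_vs = real_vector +
  fixes cscale :: "complex \<Rightarrow> 'a \<Rightarrow> 'a"
  assumes cscale_of_real: "cscale (complex_of_real r) x = scaleR r x"
    and cscale_add_right: "cscale c (x + y) = cscale c x + cscale c y"
    and cscale_add_left: "cscale (c + d) x = cscale c x + cscale d x"
    and cscale_cscale: "cscale c (cscale d x) = cscale (c * d) x"

class cstar_algebra = complex_vs + real_normed_algebra + banach +
  fixes cstar :: "'a \<Rightarrow> 'a"
  assumes cscale_mult_left: "cscale c (x * y) = cscale c x * y"
    and cscale_mult_right: "cscale c (x * y) = x * cscale c y"
    and norm_cscale: "norm (cscale c x) = cmod c * norm x"
    and cstar_cstar: "cstar (cstar x) = x"
    and cstar_add: "cstar (x + y) = cstar x + cstar y"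
    and cstar_cscale: "cstar (cscale c x) = cscale (cnj c) (cstar x)"
    and cstar_mult: "cstar (x * y) = cstar y * cstar x"
    and cstar_identity: "norm (cstar x * x) = (norm x)\<^sup>2"

definition cpos :: "'a::cstar_algebra \<Rightarrow> bool" where
  "cpos a \<longleftrightarrow> (\<exists>b. a = cstar b * b)"

definition hmod_norm :: "('m \<Rightarrow> 'm \<Rightarrow> 'a::cstar_algebra) \<Rightarrow> 'm \<Rightarrow> real" where
  "hmod_norm ip x = sqrt (norm (ip x x))"

definition hilbert_cstar_module ::
  "('m::complex_vs \<Rightarrow> 'm \<Rightarrow> 'a::cstar_algebra) \<Rightarrow> ('m \<Rightarrow> 'a \<Rightarrow> 'm) \<Rightarrow> bool" where
  "hilbert_cstar_module ip act \<longleftrightarrow>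
     (\<forall>x a b. act x (a * b) = act (act x a) b) \<and>
     (\<forall>x a b. act x (a + b) = act x a + act x b) \<and>
     (\<forall>x y a. act (x + y) a = act x a + act y a) \<and>
     (\<forall>c x a. cscale c (act x a) = act (cscale c x) a) \<and>
     (\<forall>c x a. cscale c (act x a) = act x (cscale c a)) \<and>
     (\<forall>x y z. ip x (y + z) = ip x y + ip x z) \<and>
     (\<forall>c x y. ip x (cscale c y) = cscale c (ip x y)) \<and>
     (\<forall>x y a. ip x (act y a) = ip x y * a) \<and>
     (\<forall>x y. ip y x = cstar (ip x y)) \<and>
     (\<forall>x. cpos (ip x x)) \<and>
     (\<forall>x. ip x x = 0 \<longrightarrow> x = 0) \<and>
     (\<forall>f :: nat \<Rightarrow> 'm.
        (\<forall>e>0. \<exists>N. \<forall>m\<ge>N. \<forall>n\<ge>N. hmod_norm ip (f m - f n) < e) \<longrightarrow>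
        (\<exists>x. (\<lambda>n. hmod_norm ip (f n - x)) \<longlonglongrightarrow> 0))"

definition adjointable :: "('m \<Rightarrow> 'm \<Rightarrow> 'a) \<Rightarrow> ('m \<Rightarrow> 'm) \<Rightarrow> bool" where
  "adjointable ip T \<longleftrightarrow> (\<exists>S. \<forall>x y. ip (T x) y = ip x (S y))"

definition adj :: "('m \<Rightarrow> 'm \<Rightarrow> 'a) \<Rightarrow> ('m \<Rightarrow> 'm) \<Rightarrow> ('m \<Rightarrow> 'm)" where
  "adj ip T = (THE S. \<forall>x y. ip (T x) y = ip x (S y))"

definition op_add :: "('m::real_vector \<Rightarrow> 'm) \<Rightarrow> ('m \<Rightarrow> 'm) \<Rightarrow> ('m \<Rightarrow> 'm)" where
  "op_add S T = (\<lambda>x. S x + T x)"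

definition op_diff :: "('m::real_vector \<Rightarrow> 'm) \<Rightarrow> ('m \<Rightarrow> 'm) \<Rightarrow> ('m \<Rightarrow> 'm)" where
  "op_diff S T = (\<lambda>x. S x - T x)"

definition op_scale :: "real \<Rightarrow> ('m::real_vector \<Rightarrow> 'm) \<Rightarrow> ('m \<Rightarrow> 'm)" where
  "op_scale r T = (\<lambda>x. r *\<^sub>R T x)"

definition op_pos :: "('m \<Rightarrow> 'm \<Rightarrow> 'a) \<Rightarrow> ('m \<Rightarrow> 'm) \<Rightarrow> bool" where
  "op_pos ip T \<longleftrightarrow> (\<exists>R. adjointable ip R \<and> T = adj ip R \<circ> R)"

definition op_abs :: "('m \<Rightarrow> 'm \<Rightarrow> 'a) \<Rightarrow> ('m \<Rightarrow> 'm) \<Rightarrow> ('m \<Rightarrow> 'm)" where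
  "op_abs ip T = (THE S. op_pos ip S \<and> S \<circ> S = adj ip T \<circ> T)"

definition mp_inv :: "('m \<Rightarrow> 'm \<Rightarrow> 'a) \<Rightarrow> ('m \<Rightarrow> 'm) \<Rightarrow> ('m \<Rightarrow> 'm)" where
  "mp_inv ip T = (THE X. adjointable ip X \<and> T \<circ> X \<circ> T = T \<and> X \<circ> T \<circ> X = X \<and>
       adj ip (T \<circ> X) = T \<circ> X \<and> adj ip (X \<circ> T) = X \<circ> T)"

definition op_inv :: "('m \<Rightarrow> 'm \<Rightarrow> 'a) \<Rightarrow> ('m \<Rightarrow> 'm) \<Rightarrow> ('m \<Rightarrow> 'm)" where
  "op_inv ip T = (THE X. adjointable ip X \<and> X \<circ> T = id \<and> T \<circ> X = id)"

definition range_proj :: "('m \<Rightarrow> 'm \<Rightarrow> 'a) \<Rightarrow> ('m \<Rightarrow> 'm) \<Rightarrow> ('m \<Rightarrow> 'm)" where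
  "range_proj ip T = (THE P. adjointable ip P \<and> P \<circ> P = P \<and> adj ip P = P \<and>
       range P = range T)"

definition matched_proj :: "('m::real_vector \<Rightarrow> 'm \<Rightarrow> 'a) \<Rightarrow> ('m \<Rightarrow> 'm) \<Rightarrow> ('m \<Rightarrow> 'm)" where
  "matched_proj ip Q =
     (let A = op_abs ip (adj ip Q) in
      op_scale (1/2) (op_add A (adj ip Q) \<circ> mp_inv ip A \<circ> op_inv ip (op_add A id)
                        \<circ> op_add A Q))"

definition supp_proj :: "('m::real_vector \<Rightarrow> 'm \<Rightarrow> 'a) \<Rightarrow> ('m \<Rightarrow> 'm) \<Rightarrow> ('m \<Rightarrow> 'm)" where
  "supp_proj ip Q = matched_proj ip (op_diff (op_scale 2 (range_proj ip Q)) Q)"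

end

theory Submission
  imports Defs
begin

text \<open>
  Let \<open>P\<close> be the projection onto the range of \<open>Q\<close> and \<open>N = Q - P\<close>.  Then \<open>P N = N\<close> and \<open>N P = 0\<close>, so
  \<open>Q Q\<^sup>* = P + N N\<^sup>*\<close>; replacing \<open>Q = P + N\<close> by \<open>2P - Q = P - N\<close> does not change \<open>S = |Q\<^sup>*|\<close>.  With
  \<open>G = S\<^sup>\<dagger> (S + I)\<^sup>-\<^sup>1\<close> one has \<open>G (S + P) = (S + P) G = S\<^sup>\<dagger>\<close>, hence
  \<open>s(Q) - m(Q) = - N\<^sup>* S\<^sup>\<dagger> - S\<^sup>\<dagger> N\<close>, which is the claim because \<open>S\<^sup>\<dagger>\<close> absorbs \<open>P\<close> on both sides.

  That \<open>S\<close>, \<open>S\<^sup>\<dagger>\<close>, \<open>(S + I)\<^sup>-\<^sup>1\<close> and \<open>P\<close> exist uniquely rests on the order structure of the C*-algebra of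
  adjointable operators.  It is obtained without spectral theory: positive elements are squares of
  self-adjoint ones, recognised by \<open>\<parallel>t - a\<parallel> \<le> t\<close>, and square roots come from an iteration.
\<close>

text \<open>Every operator in the formula is given by a definite description, so nothing can be
  computed before each is shown to exist uniquely; almost all the work lies there.
  \<open>op_pos\<close> only asserts the shape adjoint times operator, so the crux is
  \<open>pos_st_mult\<close>: such elements are squares of self-adjoint ones. Closedness of the
  range of S is never examined: Q Q^* is P times the invertible 1 + N N^*, and this yields the
  Moore-Penrose inverse by a formula.

  Two obstacles shape the layout. Boundedness is not part of \<open>adjointable\<close>, so a finite
  operator norm comes from a Baire argument. That argument uses Cauchy-Schwarz, whose proof for
  modules uses the order of the coefficient algebra, and that algebra need not have a unit. Hence
  the operator algebra is built twice by one locale: over the coefficient algebra itself, then over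
  H.

  In the final identity, changing N to -N in (S + N^* + P) G (S + P + N) keeps the terms even in N
  and flips the odd ones; only the two odd terms survive in the difference.\<close>

section \<open>Positive elements of unital C*-algebras\<close>

text \<open>The iteration \<open>y \<mapsto> (x + y\<^sup>2) / 2\<close> converges to \<open>1 - \<surd>(1 - x)\<close>; its increments are
  dominated by those of the scalar iteration with \<open>x = 1\<close>, which increases to \<open>1\<close>.\<close>

fun sqrt_iter :: "'c::real_algebra \<Rightarrow> nat \<Rightarrow> 'c" where
  "sqrt_iter x 0 = 0"
| "sqrt_iter x (Suc n) = (1/2) *\<^sub>R (x + sqrt_iter x n * sqrt_iter x n)"

lemma sqrt_iter_one_bounds: "0 \<le> sqrt_iter (1::real) n \<and> sqrt_iter (1::real) n \<le> 1"
proof (induction n)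
  case (Suc n)
  then have "sqrt_iter (1::real) n * sqrt_iter 1 n \<le> 1" by (simp add: mult_le_one)
  then show ?case using Suc by simp
qed simp

text \<open>The increment is half the square of \<open>1 - sqrt_iter 1 n\<close>.\<close>

lemma sqrt_iter_one_mono: "sqrt_iter (1::real) n \<le> sqrt_iter 1 (Suc n)"
proof -
  have "0 \<le> (1 - sqrt_iter (1::real) n)\<^sup>2" by simp
  then show ?thesis by (simp add: power2_eq_square algebra_simps)
qed

text \<open>A carrier set is needed because the adjointable operators depend on the inner product; the type
  class omits \<open>0 \<noteq> 1\<close> so that the zero module is covered.  The central element \<open>j\<close> plays the role of
  the imaginary unit.\<close>

locale unital_cstar =
  fixes B :: "'b::{real_algebra, monoid_mult} set"
    and st :: "'b \<Rightarrow> 'b"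
    and nrm :: "'b \<Rightarrow> real"
    and j :: 'b
  assumes one_closed [simp, intro]: "1 \<in> B"
    and add_closed [simp, intro]: "\<lbrakk>x \<in> B; y \<in> B\<rbrakk> \<Longrightarrow> x + y \<in> B"
    and mult_closed [simp, intro]: "\<lbrakk>x \<in> B; y \<in> B\<rbrakk> \<Longrightarrow> x * y \<in> B"
    and scaleR_closed [simp, intro]: "x \<in> B \<Longrightarrow> r *\<^sub>R x \<in> B"
    and st_closed [simp, intro]: "x \<in> B \<Longrightarrow> st x \<in> B"
    and st_st [simp]: "x \<in> B \<Longrightarrow> st (st x) = x"
    and st_add [simp]: "\<lbrakk>x \<in> B; y \<in> B\<rbrakk> \<Longrightarrow> st (x + y) = st x + st y"
    and st_mult [simp]: "\<lbrakk>x \<in> B; y \<in> B\<rbrakk> \<Longrightarrow> st (x * y) = st y * st x"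
    and st_scaleR [simp]: "x \<in> B \<Longrightarrow> st (r *\<^sub>R x) = r *\<^sub>R st x"
    and nrm_eq_0: "\<lbrakk>x \<in> B; nrm x = 0\<rbrakk> \<Longrightarrow> x = 0"
    and nrm_add: "\<lbrakk>x \<in> B; y \<in> B\<rbrakk> \<Longrightarrow> nrm (x + y) \<le> nrm x + nrm y"
    and nrm_scaleR: "x \<in> B \<Longrightarrow> nrm (r *\<^sub>R x) = \<bar>r\<bar> * nrm x"
    and nrm_mult: "\<lbrakk>x \<in> B; y \<in> B\<rbrakk> \<Longrightarrow> nrm (x * y) \<le> nrm x * nrm y"
    and nrm_st_mult: "x \<in> B \<Longrightarrow> nrm (st x * x) = (nrm x)\<^sup>2"
    and complete: "\<lbrakk>\<And>n::nat. f n \<in> B;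
          \<forall>e>0. \<exists>M. \<forall>m\<ge>M. \<forall>n\<ge>M. nrm (f m - f n) < e\<rbrakk>
        \<Longrightarrow> \<exists>x\<in>B. (\<lambda>n. nrm (f n - x)) \<longlonglongrightarrow> 0"
    and j_closed [simp, intro]: "j \<in> B"
    and j_central: "x \<in> B \<Longrightarrow> x * j = j * x"
    and j_j: "j * j = - 1"
    and st_j [simp]: "st j = - j"
begin

section \<open>Elementary consequences of the C*-identity\<close>

lemma zero_closed [simp, intro]: "0 \<in> B"
  using scaleR_closed[OF one_closed, of 0] by simp

lemma minus_closed [simp, intro]: "x \<in> B \<Longrightarrow> - x \<in> B"
  using scaleR_closed[of x "-1"] by simp

lemma diff_closed [simp, intro]: "\<lbrakk>x \<in> B; y \<in> B\<rbrakk> \<Longrightarrow> x - y \<in> B"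
  using add_closed[of x "- y"] by simp

lemma sum_closed: "(\<And>i. i \<in> I \<Longrightarrow> f i \<in> B) \<Longrightarrow> sum f I \<in> B"
  by (induction I rule: infinite_finite_induct) auto

lemma power_closed [simp, intro]: "x \<in> B \<Longrightarrow> x ^ n \<in> B"
  by (induction n) auto

lemma st_minus [simp]: "x \<in> B \<Longrightarrow> st (- x) = - st x"
  using st_scaleR[of x "-1"] by simp

lemma st_diff [simp]: "\<lbrakk>x \<in> B; y \<in> B\<rbrakk> \<Longrightarrow> st (x - y) = st x - st y"
  using st_add[of x "- y"] by simp

lemma st_one [simp]: "st 1 = 1"
proof -
  have "st 1 = st 1 * st (st 1)" by simp
  also have "\<dots> = st (st 1 * 1)" by (subst st_mult) auto
  finally show ?thesis by simp
qed

lemma nrm_zero [simp]: "nrm 0 = 0"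
  using nrm_scaleR[OF one_closed, of 0] by simp

lemma nrm_minus [simp]: "x \<in> B \<Longrightarrow> nrm (- x) = nrm x"
  using nrm_scaleR[of x "-1"] by simp

lemma nrm_diff: "\<lbrakk>x \<in> B; y \<in> B\<rbrakk> \<Longrightarrow> nrm (x - y) \<le> nrm x + nrm y"
  using nrm_add[of x "- y"] by simp

lemma nrm_diff_commute: "\<lbrakk>x \<in> B; y \<in> B\<rbrakk> \<Longrightarrow> nrm (x - y) = nrm (y - x)"
  using nrm_minus[of "x - y"] by simp

lemma nrm_nonneg [simp]: "x \<in> B \<Longrightarrow> 0 \<le> nrm x"
  using nrm_diff[of x x] by simp

text \<open>\<open>nrm 1\<close> equals its own square, so it is 0 or 1; the value 0 occurs in the
  zero algebra, hence an inequality.\<close>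

lemma nrm_one: "nrm 1 \<le> 1"
proof -
  have "nrm 1 * nrm 1 = nrm 1 * 1"
    using nrm_st_mult[OF one_closed] by (simp add: power2_eq_square)
  then show ?thesis by (metis mult_cancel_left one_closed order_refl zero_le_one)
qed

lemma nrm_st [simp]: assumes "x \<in> B" shows "nrm (st x) = nrm x"
proof -
  have le: "nrm y \<le> nrm (st y)" if y: "y \<in> B" for y
  proof (cases "nrm y = 0")
    case False
    then have "0 < nrm y" using nrm_nonneg[OF y] by (simp add: less_le)
    moreover have "nrm y * nrm y \<le> nrm (st y) * nrm y"
      using nrm_st_mult[OF y] nrm_mult[of "st y" y] y by (simp add: power2_eq_square)
    ultimately show ?thesis by simp
  qed (use y in simp)
  show ?thesis using le[of x] le[of "st x"] assms by simp
qed

lemma nrm_square: "\<lbrakk>x \<in> B; st x = x\<rbrakk> \<Longrightarrow> nrm (x * x) = (nrm x)\<^sup>2"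
  using nrm_st_mult[of x] by simp

lemma st_mult_eq_0: "\<lbrakk>x \<in> B; st x * x = 0\<rbrakk> \<Longrightarrow> x = 0"
  using nrm_st_mult[of x] nrm_eq_0[of x] by simp

lemma square_eq_0: "\<lbrakk>x \<in> B; st x = x; x * x = 0\<rbrakk> \<Longrightarrow> x = 0"
  using st_mult_eq_0[of x] by simp

text \<open>The fourth power vanishes too, and \<open>square_eq_0\<close> applies twice. Cubes arise
  below as products of a difference with positive elements.\<close>

lemma cube_eq_0: assumes "x \<in> B" "st x = x" "x * x * x = 0" shows "x = 0"
proof -
  have "(x * x) * (x * x) = 0" using assms by (metis mult.assoc mult_zero_left)
  then have "x * x = 0" using square_eq_0[of "x * x"] assms by simp
  then show ?thesis using square_eq_0 assms by blast
qed

section \<open>Limits and the square root of \<open>1 - x\<close>\<close>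

lemma eq_0_if_nrm_le_null:
  assumes "x \<in> B" "\<And>n. nrm x \<le> C * d n" "d \<longlonglongrightarrow> (0::real)"
  shows "x = 0"
proof -
  have "(\<lambda>n. C * d n) \<longlonglongrightarrow> 0" using tendsto_mult_left[OF assms(3), of C] by simp
  then have "nrm x \<le> 0"
    by (rule LIMSEQ_le_const) (use assms(2) in auto)
  then show ?thesis using assms(1) nrm_nonneg[OF assms(1)] nrm_eq_0[OF assms(1)] by (meson antisym)
qed

text \<open>Telescoping bounds \<open>nrm (f m - f n)\<close> by the scalar difference. No rate of
  convergence is required of \<open>s\<close>, which matters for the square root when
  \<open>nrm x = 1\<close>.\<close>

lemma limit_of_dominated:
  assumes f: "\<And>n. f n \<in> B" and s: "convergent s"
    and le: "\<And>n. nrm (f (Suc n) - f n) \<le> s (Suc n) - s n"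
  obtains x where "x \<in> B" "(\<lambda>n. nrm (f n - x)) \<longlonglongrightarrow> 0"
proof -
  have le': "nrm (f (n + k) - f n) \<le> s (n + k) - s n" for n k
  proof (induction k)
    case (Suc k)
    have "f (n + Suc k) - f n = (f (Suc (n + k)) - f (n + k)) + (f (n + k) - f n)" by simp
    then have "nrm (f (n + Suc k) - f n) \<le> nrm (f (Suc (n + k)) - f (n + k)) + nrm (f (n + k) - f n)"
      using nrm_add[of "f (Suc (n + k)) - f (n + k)" "f (n + k) - f n"] f by simp
    then show ?case using Suc le[of "n + k"] by simp
  qed simp
  have diff: "nrm (f m - f n) \<le> \<bar>s m - s n\<bar>" for m n
  proof (cases "n \<le> m")
    case True
    then show ?thesis using le'[of n "m - n"] by simp
  next
    case False
    then show ?thesis using le'[of m "n - m"] nrm_diff_commute[of "f m" "f n"] f by simp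
  qed
  have "\<forall>e>0. \<exists>M. \<forall>m\<ge>M. \<forall>n\<ge>M. nrm (f m - f n) < e"
    using s diff unfolding Cauchy_convergent_iff[symmetric] Cauchy_def dist_real_def
    by (meson le_less_trans)
  then show thesis using complete f that by blast
qed

lemma commute_limit:
  assumes "\<And>n. f n \<in> B" "x \<in> B" "(\<lambda>n. nrm (f n - x)) \<longlonglongrightarrow> 0" "z \<in> B"
    and "\<And>n. z * f n = f n * z"
  shows "z * x = x * z"
proof -
  have "z * x - x * z = 0"
  proof (rule eq_0_if_nrm_le_null[OF _ _ assms(3)])
    fix n
    have "z * x - x * z = (f n - x) * z - z * (f n - x)"
      using assms(5)[of n] by (simp add: algebra_simps)
    also have "nrm \<dots> \<le> nrm ((f n - x) * z) + nrm (z * (f n - x))"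
      using assms by (intro nrm_diff) auto
    also have "\<dots> \<le> 2 * nrm z * nrm (f n - x)"
      using nrm_mult[of "f n - x" z] nrm_mult[of z "f n - x"] assms by (simp add: mult_ac)
    finally show "nrm (z * x - x * z) \<le> 2 * nrm z * nrm (f n - x)" .
  qed (use assms in auto)
  then show ?thesis by simp
qed

text \<open>A fixed point satisfies \<open>2 y = x + y * y\<close>, so \<open>1 - y\<close> squares
  to \<open>1 - x\<close>. The iterates are polynomials in \<open>x\<close>, whence the commutation
  clause; it stands in for functional calculus throughout. The bound on \<open>y\<close> later makes
  \<open>1 - y\<close> positive.\<close>

lemma sqrt_one_minus:
  assumes x: "x \<in> B" "st x = x" "nrm x \<le> 1"
  obtains y where "y \<in> B" "st y = y" "nrm y \<le> 1" "(1 - y) * (1 - y) = 1 - x"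
    "\<And>z. \<lbrakk>z \<in> B; z * x = x * z\<rbrakk> \<Longrightarrow> z * y = y * z"
proof -
  define f where "f = sqrt_iter x"
  define s where "s = sqrt_iter (1::real)"
  have f_Suc: "f (Suc n) = (1/2) *\<^sub>R (x + f n * f n)" for n by (simp add: f_def)
  have s_Suc: "s (Suc n) = (1/2) * (1 + s n * s n)" for n by (simp add: s_def)
  have fB: "f n \<in> B" for n by (induction n) (use x in \<open>auto simp: f_def\<close>)
  have f_sa: "st (f n) = f n" for n
  proof (induction n)
    case 0
    then show ?case using st_scaleR[OF one_closed, of 0] by (simp add: f_def)
  qed (use x fB in \<open>simp add: f_Suc\<close>)
  have f_comm: "z * f n = f n * z" if "z \<in> B" "z * x = x * z" for z n
  proof (induction n)
    case (Suc n)
    then have "z * (f n * f n) = f n * f n * z" by (metis mult.assoc)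
    then show ?case using that by (simp add: f_Suc algebra_simps)
  qed (simp add: f_def)
  have s01: "0 \<le> s n" "s n \<le> 1" for n using sqrt_iter_one_bounds by (auto simp: s_def)
  have f_s: "nrm (f n) \<le> s n" for n
  proof (induction n)
    case (Suc n)
    have "nrm (x + f n * f n) \<le> nrm x + nrm (f n * f n)" using x fB by (intro nrm_add) auto
    also have "nrm (f n * f n) \<le> s n * s n"
      using nrm_mult[of "f n" "f n"] fB Suc mult_mono[OF Suc Suc] s01 by force
    finally show ?case using x fB by (simp add: f_Suc s_Suc nrm_scaleR)
  qed (simp add: f_def s_def)
  have step: "nrm (f (Suc n) - f n) \<le> s (Suc n) - s n" for n
  proof (induction n)
    case 0
    then show ?case using x by (simp add: f_def s_def nrm_scaleR)
  next
    case (Suc n)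
    have c: "f (Suc n) * f n = f n * f (Suc n)"
      by (rule f_comm[OF fB f_comm[OF x(1) refl, symmetric]])
    \<comment> \<open>The increment is half a difference of squares, which factors because
      consecutive iterates commute; the scalar sequence satisfies the same identity.\<close>
    have "f (Suc (Suc n)) - f (Suc n) = (1/2) *\<^sub>R (f (Suc n) * f (Suc n) - f n * f n)"
      unfolding f_Suc[of "Suc n"] by (subst (3) f_Suc) (simp add: algebra_simps)
    also have "f (Suc n) * f (Suc n) - f n * f n = (f (Suc n) - f n) * (f (Suc n) + f n)"
      using c by (simp add: algebra_simps)
    finally have "nrm (f (Suc (Suc n)) - f (Suc n))
        \<le> (1/2) * (nrm (f (Suc n) - f n) * nrm (f (Suc n) + f n))"
      using nrm_mult[of "f (Suc n) - f n" "f (Suc n) + f n"] fB by (simp add: nrm_scaleR)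
    also have "\<dots> \<le> (1/2) * ((s (Suc n) - s n) * (s (Suc n) + s n))"
    proof -
      have "nrm (f (Suc n) + f n) \<le> s (Suc n) + s n"
        using nrm_add[of "f (Suc n)" "f n"] fB f_s[of n] f_s[of "Suc n"] by fastforce
      then show ?thesis
        using Suc fB sqrt_iter_one_mono[of n]
        by (intro mult_left_mono mult_mono) (auto simp: s_def)
    qed
    also have "\<dots> = s (Suc (Suc n)) - s (Suc n)"
      unfolding s_Suc[of "Suc n"] using s_Suc[of n] by (simp add: algebra_simps)
    finally show ?case .
  qed
  have conv: "convergent s"
  proof (rule Bseq_mono_convergent)
    show "Bseq s" using s01 by (intro BseqI'[where K = 1]) simp
    show "\<forall>m n. m \<le> n \<longrightarrow> s m \<le> s n"
      unfolding s_def using lift_Suc_mono_le[of "sqrt_iter (1::real)"] sqrt_iter_one_mono by blast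
  qed
  obtain y where y: "y \<in> B" and lim: "(\<lambda>n. nrm (f n - y)) \<longlonglongrightarrow> 0"
    using limit_of_dominated[OF fB conv step] by blast
  have comm: "z * y = y * z" if "z \<in> B" "z * x = x * z" for z
    using commute_limit[OF fB y lim that(1) f_comm[OF that]] .
  have "st y - y = 0"
  proof (rule eq_0_if_nrm_le_null[OF _ _ lim])
    fix n
    have "st y - y = (f n - y) - st (f n - y)" using y fB f_sa by simp
    also have "nrm \<dots> \<le> nrm (f n - y) + nrm (st (f n - y))"
      using y fB by (intro nrm_diff) auto
    finally show "nrm (st y - y) \<le> 2 * nrm (f n - y)" using y fB by (simp del: st_diff)
  qed (use y in auto)
  then have y_sa: "st y = y" by simp
  have y_nrm: "nrm y \<le> 1"
  proof -
    have lim1: "(\<lambda>n. nrm (f n - y) + 1) \<longlonglongrightarrow> 1"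
      using tendsto_add[OF lim tendsto_const[of 1]] by simp
    have "nrm y \<le> nrm (f n - y) + 1" for n
      using nrm_diff[of "f n" "f n - y"] y fB f_s[of n] s01(2)[of n] by simp
    then show ?thesis using LIMSEQ_le_const[OF lim1] by blast
  qed
  have "x + y * y - 2 *\<^sub>R y = 0"
  proof (rule eq_0_if_nrm_le_null[OF _ _])
    show "(\<lambda>n. nrm (f n - y) + nrm (f (Suc n) - y)) \<longlonglongrightarrow> 0"
      using tendsto_add[OF lim LIMSEQ_Suc[OF lim]] by simp
    fix n
    have "y * f n = f n * y" using f_comm[OF y comm[OF x(1) refl, symmetric]] .
    \<comment> \<open>Since \<open>2 f (Suc n) = x + f n * f n\<close>, the defect of the
      fixed-point equation is a sum of two terms that each contain an error tending to 0.\<close>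
    then have "x + y * y - 2 *\<^sub>R y = 2 *\<^sub>R (f (Suc n) - y) - (f n - y) * (f n + y)"
      by (simp add: f_Suc algebra_simps scaleR_2)
    also have "nrm \<dots> \<le> nrm (2 *\<^sub>R (f (Suc n) - y)) + nrm ((f n - y) * (f n + y))"
      using y fB by (intro nrm_diff) auto
    also have "\<dots> \<le> 2 * nrm (f (Suc n) - y) + nrm (f n - y) * 2"
    proof -
      have "nrm (f n + y) \<le> 2"
        using nrm_add[of "f n" y] y fB f_s[of n] s01(2)[of n] y_nrm by simp
      then have "nrm (f n - y) * nrm (f n + y) \<le> nrm (f n - y) * 2"
        using y fB by (intro mult_left_mono) auto
      then show ?thesis
        using nrm_mult[of "f n - y" "f n + y"] y fB by (simp add: nrm_scaleR)
    qed
    finally show "nrm (x + y * y - 2 *\<^sub>R y) \<le> 2 * (nrm (f n - y) + nrm (f (Suc n) - y))"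
      by simp
  qed (use x y in auto)
  then have "(1 - y) * (1 - y) = 1 - x"
    by (simp add: algebra_simps scaleR_2)
  then show thesis using that y y_sa y_nrm comm by blast
qed

section \<open>The cone of positive elements\<close>

definition pos :: "'b \<Rightarrow> bool" where
  "pos a \<longleftrightarrow> (\<exists>h\<in>B. st h = h \<and> a = h * h)"

lemma pos_square: "\<lbrakk>h \<in> B; st h = h\<rbrakk> \<Longrightarrow> pos (h * h)"
  by (auto simp: pos_def)

lemma pos_closed: "pos a \<Longrightarrow> a \<in> B"
  and pos_sa: "pos a \<Longrightarrow> st a = a"
  by (auto simp: pos_def)

lemma pos_scaleR: assumes "pos a" "0 \<le> r" shows "pos (r *\<^sub>R a)"
proof -
  obtain h where h: "h \<in> B" "st h = h" "a = h * h" using assms by (auto simp: pos_def)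
  have "r *\<^sub>R a = (sqrt r *\<^sub>R h) * (sqrt r *\<^sub>R h)" using h assms by simp
  then show ?thesis using h pos_square[of "sqrt r *\<^sub>R h"] by (metis scaleR_closed st_scaleR)
qed

lemma sqrt_near_scalar:
  assumes a: "a \<in> B" "st a = a" and t: "0 < t" "nrm (t *\<^sub>R 1 - a) \<le> t"
  obtains y where "y \<in> B" "st y = y" "nrm y \<le> 1"
    "(sqrt t *\<^sub>R (1 - y)) * (sqrt t *\<^sub>R (1 - y)) = a"
    "\<And>z. \<lbrakk>z \<in> B; z * a = a * z\<rbrakk> \<Longrightarrow> z * y = y * z"
proof -
  define x where "x = 1 - (1/t) *\<^sub>R a"
  have x: "x = (1/t) *\<^sub>R (t *\<^sub>R 1 - a)" using t by (simp add: x_def algebra_simps)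
  have "nrm x \<le> 1" unfolding x using a t by (subst nrm_scaleR) (auto simp: divide_le_eq_1)
  moreover have "x \<in> B" "st x = x" using a by (auto simp: x_def)
  ultimately obtain y where y: "y \<in> B" "st y = y" "nrm y \<le> 1" "(1 - y) * (1 - y) = 1 - x"
    "\<And>z. \<lbrakk>z \<in> B; z * x = x * z\<rbrakk> \<Longrightarrow> z * y = y * z"
    using sqrt_one_minus[of x] by blast
  have "(sqrt t *\<^sub>R (1 - y)) * (sqrt t *\<^sub>R (1 - y)) = t *\<^sub>R ((1 - y) * (1 - y))"
    using t by simp
  also have "\<dots> = a" using t y(4) by (simp add: x_def)
  finally have "(sqrt t *\<^sub>R (1 - y)) * (sqrt t *\<^sub>R (1 - y)) = a" .
  moreover have "z * y = y * z" if "z \<in> B" "z * a = a * z" for z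
    using that y(5)[of z] by (simp add: x_def algebra_simps)
  ultimately show thesis using that y by blast
qed

text \<open>With its converse \<open>pos_nrm_scalar_minus\<close> this turns positivity into a norm
  condition, so that sums can be handled by the triangle inequality.\<close>

lemma pos_near_scalar:
  assumes "a \<in> B" "st a = a" "0 < t" "nrm (t *\<^sub>R 1 - a) \<le> t"
  shows "pos a"
proof -
  obtain y where "y \<in> B" "st y = y" "(sqrt t *\<^sub>R (1 - y)) * (sqrt t *\<^sub>R (1 - y)) = a"
    using sqrt_near_scalar[OF assms] by blast
  then show ?thesis using pos_square[of "sqrt t *\<^sub>R (1 - y)"] by simp
qed

text \<open>The element \<open>a + i w\<close> is unitary and \<open>a\<close> is its real part.\<close>

lemma nrm_le_1_if_sum_squares_eq_1:
  assumes a: "a \<in> B" "st a = a" and w: "w \<in> B" "st w = w"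
    and c: "a * w = w * a" and one: "a * a + w * w = 1"
  shows "nrm a \<le> 1"
proof -
  define u where "u = a + j * w"
  have uB: "u \<in> B" using a w by (simp add: u_def)
  have stu: "st u = a - j * w" using a w j_central[of w] by (simp add: u_def)
  have "j * w * (j * w) = j * j * (w * w)" using j_central[of w] w by (metis mult.assoc)
  then have jj: "j * w * (j * w) = - (w * w)" using j_j by simp
  have aj: "a * (j * w) = j * w * a" using j_central[of a] a c by (metis mult.assoc)
  have "st u * u = a * a + w * w"
    unfolding stu using jj aj by (simp add: u_def algebra_simps)
  then have "(nrm u)\<^sup>2 = nrm 1" using nrm_st_mult[OF uB] one by simp
  then have u1: "nrm u \<le> 1" using nrm_one
    by (metis abs_le_square_iff abs_of_nonneg uB nrm_nonneg abs_one one_power2)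
  have "a = (1/2) *\<^sub>R (u + st u)" unfolding stu by (simp add: u_def flip: scaleR_2)
  then have "nrm a = (1/2) * nrm (u + st u)" using uB by (simp add: nrm_scaleR)
  then show ?thesis using u1 nrm_add[of u "st u"] uB by simp
qed

text \<open>\<open>1 - a * a\<close> is the square of some \<open>1 - y\<close> commuting with
  \<open>a\<close>. The squares of \<open>a\<close> and \<open>1 - y\<close> sum to 1, so the
  previous lemma applies with \<open>1 - y\<close> in the role of the real part.\<close>

lemma nrm_one_minus_square:
  assumes a: "a \<in> B" "st a = a" "nrm a \<le> 1"
  shows "nrm (1 - a * a) \<le> 1"
proof -
  have "nrm (a * a) \<le> 1" using a by (simp add: nrm_square power_le_one)
  then obtain y where y: "y \<in> B" "st y = y" "(1 - y) * (1 - y) = 1 - a * a"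
    "\<And>z. \<lbrakk>z \<in> B; z * (a * a) = (a * a) * z\<rbrakk> \<Longrightarrow> z * y = y * z"
    using sqrt_one_minus[of "a * a"] a by auto
  have "a * y = y * a" using y(4)[of a] a by (simp add: mult.assoc)
  then have "nrm (1 - y) \<le> 1"
    using a y by (intro nrm_le_1_if_sum_squares_eq_1[where w = a]) (auto simp: algebra_simps)
  then show ?thesis using y nrm_square[of "1 - y"] by (simp add: power_le_one)
qed

lemma pos_nrm_scalar_minus:
  assumes "pos a" "nrm a \<le> t" shows "nrm (t *\<^sub>R 1 - a) \<le> t"
proof (cases "t = 0")
  case True
  then have "a = 0" using assms nrm_eq_0[OF pos_closed] nrm_nonneg[OF pos_closed] by (metis antisym)
  then show ?thesis using True by simp
next
  case False
  obtain h where h: "h \<in> B" "st h = h" "a = h * h" using assms(1) by (auto simp: pos_def)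
  have "0 \<le> t" using assms nrm_nonneg[OF pos_closed] order_trans by blast
  with False have t: "0 < t" by simp
  define k where "k = (1 / sqrt t) *\<^sub>R h"
  have "(nrm h)\<^sup>2 \<le> t" using h assms nrm_square by simp
  then have "nrm h \<le> sqrt t" using real_le_rsqrt by blast
  then have "nrm k \<le> 1" using t h by (simp add: k_def nrm_scaleR)
  then have "nrm (1 - k * k) \<le> 1" using nrm_one_minus_square[of k] h by (simp add: k_def)
  moreover have "k * k = (1 / t) *\<^sub>R a" using t h by (simp add: k_def)
  then have "t *\<^sub>R 1 - a = t *\<^sub>R (1 - k * k)" using t by (simp add: algebra_simps)
  ultimately show ?thesis using t h by (simp add: nrm_scaleR k_def)
qed

text \<open>The norm conditions for \<open>a\<close> with \<open>s\<close> and for \<open>b\<close>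
  with \<open>t\<close> add up to the one for \<open>a + b\<close> with \<open>s + t\<close>. The
  summands 1 keep the scalar strictly positive.\<close>

lemma pos_add: assumes "pos a" "pos b" shows "pos (a + b)"
proof -
  define s where "s = nrm a + 1"
  define t where "t = nrm b + 1"
  have B: "a \<in> B" "b \<in> B" using assms pos_closed by auto
  have "(s + t) *\<^sub>R 1 - (a + b) = (s *\<^sub>R 1 - a) + (t *\<^sub>R 1 - b)"
    by (simp add: algebra_simps)
  also have "nrm \<dots> \<le> nrm (s *\<^sub>R 1 - a) + nrm (t *\<^sub>R 1 - b)"
    using B by (intro nrm_add) auto
  also have "\<dots> \<le> s + t"
    using pos_nrm_scalar_minus[of a s] pos_nrm_scalar_minus[of b t] assms
    by (simp add: s_def t_def)
  finally show ?thesis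
    using B assms pos_sa
    by (intro pos_near_scalar[of _ "s + t"]) (auto simp: s_def t_def add_nonneg_pos intro!: add_pos_nonneg)
qed

lemma pos_scalar_minus:
  assumes "a \<in> B" "st a = a" "0 < t" "nrm a \<le> t"
  shows "pos (t *\<^sub>R 1 - a)"
  using assms by (intro pos_near_scalar[of _ t]) auto

lemma pos_sqrt:
  assumes "pos a"
  obtains r where "pos r" "r * r = a" "\<And>z. \<lbrakk>z \<in> B; z * a = a * z\<rbrakk> \<Longrightarrow> z * r = r * z"
proof -
  define t where "t = nrm a + 1"
  have a: "a \<in> B" "st a = a" using assms pos_closed pos_sa by auto
  then have t: "0 < t" by (simp add: t_def add_nonneg_pos)
  have "nrm (t *\<^sub>R 1 - a) \<le> t" using pos_nrm_scalar_minus[of a t] assms by (simp add: t_def)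
  then obtain y where y: "y \<in> B" "st y = y" "nrm y \<le> 1"
    "(sqrt t *\<^sub>R (1 - y)) * (sqrt t *\<^sub>R (1 - y)) = a"
    "\<And>z. \<lbrakk>z \<in> B; z * a = a * z\<rbrakk> \<Longrightarrow> z * y = y * z"
    using sqrt_near_scalar[OF a t] by blast
  have "pos (1 *\<^sub>R 1 - y)" using y by (intro pos_scalar_minus) auto
  then have "pos (sqrt t *\<^sub>R (1 - y))" using t by (simp add: pos_scaleR)
  moreover have "z * (sqrt t *\<^sub>R (1 - y)) = (sqrt t *\<^sub>R (1 - y)) * z"
    if "z \<in> B" "z * a = a * z" for z
    using y(5)[OF that] by (simp add: algebra_simps)
  ultimately show thesis using that y(4) by blast
qed

text \<open>Commuting square roots of \<open>p\<close> and \<open>t - p\<close>, divided by the root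
  of \<open>t\<close>, have squares summing to 1, so each is the real part of a unitary up to
  order.\<close>

lemma pos_nrm_le:
  assumes p: "pos p" and q: "pos (t *\<^sub>R 1 - p)" and t: "0 < t"
  shows "nrm p \<le> t"
proof -
  obtain h where h: "h \<in> B" "st h = h" "p = h * h" using p by (auto simp: pos_def)
  obtain r where r: "pos r" "r * r = t *\<^sub>R 1 - p"
    "\<And>z. \<lbrakk>z \<in> B; z * (t *\<^sub>R 1 - p) = (t *\<^sub>R 1 - p) * z\<rbrakk> \<Longrightarrow> z * r = r * z"
    using pos_sqrt[OF q] by blast
  have hr: "h * r = r * h" using r(3)[of h] h by (simp add: algebra_simps)
  define c where "c = 1 / sqrt t"
  have c: "c * c = 1 / t" using t by (simp add: c_def)
  have "(c *\<^sub>R h) * (c *\<^sub>R h) + (c *\<^sub>R r) * (c *\<^sub>R r) = (c * c) *\<^sub>R (h * h + r * r)"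
    by (simp add: scaleR_add_right)
  also have "h * h + r * r = t *\<^sub>R 1" unfolding r(2) h(3) by simp
  finally have "(c *\<^sub>R h) * (c *\<^sub>R h) + (c *\<^sub>R r) * (c *\<^sub>R r) = 1" using t c by simp
  then have "nrm (c *\<^sub>R h) \<le> 1"
    using h pos_closed[OF r(1)] pos_sa[OF r(1)] hr
    by (intro nrm_le_1_if_sum_squares_eq_1[of "c *\<^sub>R h" "c *\<^sub>R r"]) simp_all
  then have "nrm h \<le> sqrt t" using h t by (simp add: nrm_scaleR c_def)
  then have "(nrm h)\<^sup>2 \<le> t" using h t
    by (metis nrm_nonneg power_mono real_sqrt_pow2 less_imp_le)
  then show ?thesis using h nrm_square by simp
qed

text \<open>\<open>p\<close> lies below \<open>p + q\<close>, hence below any scalar exceeding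
  \<open>nrm (p + q)\<close>; the epsilon keeps that scalar positive.\<close>

lemma pos_nrm_mono:
  assumes "pos p" "pos q" shows "nrm p \<le> nrm (p + q)"
proof (rule field_le_epsilon)
  fix e :: real assume e: "0 < e"
  have B: "p \<in> B" "q \<in> B" "st p = p" "st q = q" using assms pos_closed pos_sa by auto
  define t where "t = nrm (p + q) + e"
  have t: "0 < t" using e nrm_nonneg[of "p + q"] B by (simp add: t_def add_nonneg_pos)
  have "pos (t *\<^sub>R 1 - (p + q))" using B t e by (intro pos_scalar_minus) (auto simp: t_def)
  then have "pos (t *\<^sub>R 1 - (p + q) + q)" using pos_add assms by blast
  then have "pos (t *\<^sub>R 1 - p)" by simp
  then show "nrm p \<le> nrm (p + q) + e" using pos_nrm_le assms t by (simp add: t_def)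
qed

lemma pos_add_eq_0: "\<lbrakk>pos p; pos q; p + q = 0\<rbrakk> \<Longrightarrow> p = 0"
  using pos_nrm_mono[of p q] nrm_eq_0[of p] nrm_nonneg[of p] pos_closed[of p] by (metis antisym nrm_zero)

section \<open>Invertibility and the positivity of \<open>st b * b\<close>\<close>

lemma neumann_inverse:
  assumes x: "x \<in> B" "nrm x < 1"
  obtains y where "y \<in> B" "(1 - x) * y = 1" "y * (1 - x) = 1"
proof -
  define f where "f n = (\<Sum>k<n. x ^ k)" for n
  define s where "s n = (\<Sum>k<n. nrm x ^ k)" for n
  have x0: "0 \<le> nrm x" using x by simp
  have fB: "f n \<in> B" for n unfolding f_def using x by (intro sum_closed) auto
  have xn: "nrm (x ^ n) \<le> nrm x ^ n" for n
  proof (induction n)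
    case (Suc n)
    have "nrm (x ^ Suc n) \<le> nrm x * nrm (x ^ n)" using nrm_mult[of x "x ^ n"] x by simp
    also have "\<dots> \<le> nrm x * nrm x ^ n" using Suc x0 by (intro mult_left_mono) auto
    finally show ?case by simp
  qed (simp add: nrm_one)
  have "convergent s"
    using summable_geometric[of "nrm x"] x x0 unfolding s_def summable_iff_convergent by simp
  moreover have "nrm (f (Suc n) - f n) \<le> s (Suc n) - s n" for n
    using xn by (simp add: f_def s_def)
  ultimately obtain y where y: "y \<in> B" and lim: "(\<lambda>n. nrm (f n - y)) \<longlonglongrightarrow> 0"
    using limit_of_dominated fB by blast
  have xf: "x * f n = f n * x" for n
    by (simp add: f_def sum_distrib_left sum_distrib_right power_commutes)
  have xy: "x * y = y * x" using commute_limit[OF fB y lim x(1) xf] .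
  have tele: "(1 - x) * f n = 1 - x ^ n" for n
  proof (induction n)
    case (Suc n)
    have "(1 - x) * f (Suc n) = (1 - x) * f n + (1 - x) * x ^ n"
      by (simp add: f_def distrib_left)
    then show ?case unfolding Suc by (simp add: left_diff_distrib)
  qed (simp add: f_def)
  have "1 - (1 - x) * y = 0"
  proof (rule eq_0_if_nrm_le_null)
    show "(\<lambda>n. nrm x ^ n + nrm (1 - x) * nrm (f n - y)) \<longlonglongrightarrow> 0"
      using tendsto_add[OF LIMSEQ_realpow_zero[OF x0 x(2)] tendsto_mult_left[OF lim, of "nrm (1 - x)"]]
      by simp
    fix n
    have "1 - (1 - x) * y = x ^ n + (1 - x) * (f n - y)"
      using tele[of n] by (simp add: right_diff_distrib)
    then have "nrm (1 - (1 - x) * y) \<le> nrm (x ^ n) + nrm ((1 - x) * (f n - y))"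
      using nrm_add[of "x ^ n" "(1 - x) * (f n - y)"] x y fB by simp
    then show "nrm (1 - (1 - x) * y) \<le> 1 * (nrm x ^ n + nrm (1 - x) * nrm (f n - y))"
      using xn[of n] nrm_mult[of "1 - x" "f n - y"] x y fB by fastforce
  qed (use x y in auto)
  then have "(1 - x) * y = 1" by simp
  moreover have "y * (1 - x) = 1" using calculation xy by (simp add: algebra_simps)
  ultimately show thesis using that y by blast
qed

text \<open>With \<open>t = nrm a\<close>, \<open>1 + a\<close> is \<open>t + 1\<close> times
  \<open>1 - x\<close>, where \<open>nrm x\<close> is at most \<open>t / (t + 1)\<close>, so the
  Neumann series applies.\<close>

lemma pos_one_plus_inverse:
  assumes "pos a" obtains y where "y \<in> B" "(1 + a) * y = 1" "y * (1 + a) = 1"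
proof -
  define t where "t = nrm a"
  have a: "a \<in> B" using assms pos_closed by auto
  then have t: "0 \<le> t" by (simp add: t_def)
  define x where "x = (1 / (t + 1)) *\<^sub>R (t *\<^sub>R 1 - a)"
  have xB: "x \<in> B" using a by (simp add: x_def)
  have "nrm x \<le> t / (t + 1)"
    using pos_nrm_scalar_minus[of a t] assms t a
    by (simp add: x_def nrm_scaleR t_def divide_right_mono)
  also have "\<dots> < 1" using t by simp
  finally obtain z where z: "z \<in> B" "(1 - x) * z = 1" "z * (1 - x) = 1"
    using neumann_inverse xB by blast
  have "1 - x = (1 / (t + 1)) *\<^sub>R ((t + 1) *\<^sub>R 1 - (t *\<^sub>R 1 - a))"
    using t by (simp add: x_def scaleR_diff_right)
  also have "(t + 1) *\<^sub>R 1 - (t *\<^sub>R 1 - a) = 1 + a" by (simp add: algebra_simps)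
  finally have "1 - x = (1 / (t + 1)) *\<^sub>R (1 + a)" .
  with z show thesis using that[of "(1 / (t + 1)) *\<^sub>R z"] by simp
qed

text \<open>This replaces the fact that the norm of a positive element lies in its spectrum. An
  inverse of \<open>t - p\<close> would bound \<open>t - p\<close> below by some
  \<open>1 / m\<close>, forcing \<open>nrm p \<le> t - 1 / m\<close>.\<close>

lemma pos_scalar_nrm_minus_not_invertible:
  assumes p: "pos p" "0 < nrm p" and y: "y \<in> B" "(nrm p *\<^sub>R 1 - p) * y = 1" "y * (nrm p *\<^sub>R 1 - p) = 1"
  shows False
proof -
  define t where "t = nrm p"
  define g where "g = t *\<^sub>R 1 - p"
  have pB: "p \<in> B" "st p = p" using p pos_closed pos_sa by auto
  have g: "g \<in> B" "st g = g" "pos g" and gy: "g * y = 1" "y * g = 1"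
    using pos_scalar_minus[of p t] p pB y by (auto simp: g_def t_def)
  obtain r where r: "pos r" "r * r = g" "\<And>z. \<lbrakk>z \<in> B; z * g = g * z\<rbrakk> \<Longrightarrow> z * r = r * z"
    using pos_sqrt g(3) by blast
  have rB: "r \<in> B" "st r = r" using r pos_closed pos_sa by auto
  have yr: "y * r = r * y" using r(3)[of y] y gy by simp
  have sty: "st y = y"
  proof -
    have "st y * g = 1" using st_mult[of g y] g gy y by simp
    then show ?thesis using gy by (metis mult.assoc mult.right_neutral mult.left_neutral)
  qed
  have "y = (r * y) * (r * y)"
    using yr r(2) gy by (metis mult.assoc mult.left_neutral)
  then have "pos y" using pos_square[of "r * y"] rB y sty yr by simp
  \<comment> \<open>The first entry makes \<open>m - y\<close> positive; the second keeps
    \<open>t - 1 / m\<close> at least \<open>t / 2\<close>, as \<open>pos_nrm_le\<close> asks for a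
    positive scalar.\<close>
  define m where "m = max (nrm y) (2 / t)"
  have m: "0 < m" "nrm y \<le> m" "2 / t \<le> m" using p by (auto simp: m_def t_def less_max_iff_disj)
  have "pos (m *\<^sub>R 1 - y)" using m y sty by (intro pos_scalar_minus) auto
  then obtain w where w: "pos w" "w * w = m *\<^sub>R 1 - y"
    "\<And>z. \<lbrakk>z \<in> B; z * (m *\<^sub>R 1 - y) = (m *\<^sub>R 1 - y) * z\<rbrakk> \<Longrightarrow> z * w = w * z"
    using pos_sqrt by blast
  have wB: "w \<in> B" "st w = w" using w pos_closed pos_sa by auto
  have rw: "r * w = w * r" using w(3)[of r] rB yr by (simp add: algebra_simps)
  \<comment> \<open>Multiplying \<open>m - y\<close> by \<open>g\<close> gives
    \<open>m g - 1\<close>; commuting roots exhibit the product as a square.\<close>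
  have "(r * w) * (r * w) = (r * r) * (w * w)" using rw by (metis mult.assoc)
  also have "\<dots> = m *\<^sub>R g - 1" unfolding r(2) w(2) using gy by (simp add: algebra_simps)
  finally have "pos (m *\<^sub>R g - 1)" using pos_square[of "r * w"] rB wB rw by simp
  then have "pos ((1 / m) *\<^sub>R (m *\<^sub>R g - 1))" using m pos_scaleR by simp
  also have "(1 / m) *\<^sub>R (m *\<^sub>R g - 1) = (t - 1 / m) *\<^sub>R 1 - p"
    using m by (simp add: g_def algebra_simps)
  finally have "pos ((t - 1 / m) *\<^sub>R 1 - p)" .
  moreover have "0 < t - 1 / m"
  proof -
    have "1 / m \<le> t / 2" using m p by (simp add: t_def field_simps)
    then show ?thesis using p by (simp add: t_def)
  qed
  ultimately have "t \<le> t - 1 / m" using pos_nrm_le p by (simp add: t_def)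
  then show False using m by simp
qed

text \<open>The sum of \<open>st d * d\<close> and \<open>d * st d\<close> is positive, so here
  \<open>d * st d\<close> is positive and \<open>1 + d * st d / t\<close> is invertible.
  Invertibility passes to \<open>1 + st d * d / t\<close>; but for \<open>t = nrm (st d * d)\<close>
  nonzero, the preceding lemma forbids it.\<close>

lemma eq_0_if_neg_st_mult_pos:
  assumes d: "d \<in> B" and k: "pos (- (st d * d))"
  shows "d = 0"
proof (rule ccontr)
  assume "d \<noteq> 0"
  define t where "t = nrm (- (st d * d))"
  have "t = (nrm d)\<^sup>2" using d nrm_st_mult by (simp add: t_def)
  then have t: "0 < t" using \<open>d \<noteq> 0\<close> d nrm_eq_0[of d] by auto
  \<comment> \<open>Up to sign, \<open>X\<close> and \<open>Y\<close> are twice the real and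
    imaginary parts of \<open>d\<close>.\<close>
  define X where "X = d + st d"
  define Y where "Y = j * (d - st d)"
  have X: "X \<in> B" "st X = X" using d by (auto simp: X_def)
  have Y: "Y \<in> B" "st Y = Y"
    using d j_central[of "d - st d"] by (auto simp: Y_def algebra_simps)
  have "Y * Y = j * j * ((d - st d) * (d - st d))"
    unfolding Y_def using j_central[of "d - st d"] d by (metis mult.assoc diff_closed st_closed)
  then have "Y * Y = - ((d - st d) * (d - st d))" using j_j by simp
  then have XY: "X * X + Y * Y = 2 *\<^sub>R (st d * d + d * st d)"
    by (simp add: X_def algebra_simps scaleR_2)
  have "pos ((1/2) *\<^sub>R (X * X + Y * Y))" by (intro pos_scaleR pos_add pos_square X Y) simp
  then have "pos ((1/2) *\<^sub>R (X * X + Y * Y) + - (st d * d))" using pos_add k by blast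
  then have "pos (d * st d)" unfolding XY by simp
  then have "pos ((1 / t) *\<^sub>R (d * st d))" using t pos_scaleR by simp
  then obtain e where e: "e \<in> B" "(1 + (1 / t) *\<^sub>R (d * st d)) * e = 1"
    "e * (1 + (1 / t) *\<^sub>R (d * st d)) = 1"
    using pos_one_plus_inverse by blast
  define c where "c = 1 / t"
  \<comment> \<open>Jacobson: \<open>v\<close> inverts \<open>1 + c d\<^sup>* d\<close> because \<open>e\<close> inverts \<open>1 + c d d\<^sup>*\<close>.\<close>
  define v where "v = 1 - c *\<^sub>R (st d * e * d)"
  have e1: "c *\<^sub>R (d * (st d * e)) = 1 - e" and e2: "c *\<^sub>R (e * (d * st d)) = 1 - e"
    using e by (simp_all add: c_def algebra_simps)
  have "(1 + c *\<^sub>R (st d * d)) * v = 1 + c *\<^sub>R (st d * d) - c *\<^sub>R (st d * (e + c *\<^sub>R (d * (st d * e))) * d)"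
    by (simp add: v_def algebra_simps)
  then have v1: "(1 + c *\<^sub>R (st d * d)) * v = 1" unfolding e1 by (simp add: mult.assoc)
  have "v * (1 + c *\<^sub>R (st d * d)) = 1 + c *\<^sub>R (st d * d) - c *\<^sub>R (st d * (e + c *\<^sub>R (e * (d * st d))) * d)"
    by (simp add: v_def algebra_simps)
  then have v2: "v * (1 + c *\<^sub>R (st d * d)) = 1" unfolding e2 by (simp add: mult.assoc)
  have g: "t *\<^sub>R 1 - - (st d * d) = t *\<^sub>R (1 + c *\<^sub>R (st d * d))"
    using t by (simp add: c_def algebra_simps)
  show False
  proof (rule pos_scalar_nrm_minus_not_invertible[OF k])
    show "(1 / t) *\<^sub>R v \<in> B" using d e by (simp add: v_def)
    show "(nrm (- (st d * d)) *\<^sub>R 1 - - (st d * d)) * (1 / t) *\<^sub>R v = 1"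
      "(1 / t) *\<^sub>R v * (nrm (- (st d * d)) *\<^sub>R 1 - - (st d * d)) = 1"
      unfolding t_def[symmetric] g using v1 v2 t by simp_all
  qed (use t t_def in simp)
qed

text \<open>Writing \<open>v = |c| - c\<close> for \<open>c = b\<^sup>* b\<close>, one has \<open>v c v = - v\<^sup>3 / 2\<close> and \<open>v\<^sup>3 \<ge> 0\<close>, so the
  previous lemma applies to \<open>b v\<close>.\<close>

theorem pos_st_mult: assumes b: "b \<in> B" shows "pos (st b * b)"
proof -
  define c where "c = st b * b"
  have c: "c \<in> B" "st c = c" using b by (auto simp: c_def)
  obtain m where m: "pos m" "m * m = c * c"
    "\<And>z. \<lbrakk>z \<in> B; z * (c * c) = (c * c) * z\<rbrakk> \<Longrightarrow> z * m = m * z"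
    using pos_sqrt[OF pos_square[OF c]] by blast
  have mB: "m \<in> B" "st m = m" using m pos_closed pos_sa by auto
  have cm: "c * m = m * c" using m(3)[of c] c by (simp add: mult.assoc)
  obtain k where k: "pos k" "k * k = m" "\<And>z. \<lbrakk>z \<in> B; z * m = m * z\<rbrakk> \<Longrightarrow> z * k = k * z"
    using pos_sqrt[OF m(1)] by blast
  have kB: "k \<in> B" "st k = k" using k pos_closed pos_sa by auto
  define v where "v = m - c"
  have v: "v \<in> B" "st v = v" using mB c by (auto simp: v_def)
  have vm: "v * m = m * v" using cm by (simp add: v_def algebra_simps)
  have vk: "v * k = k * v" using k(3)[of v] v vm by simp
  \<comment> \<open>Both identities come from \<open>m * m = c * c\<close>: \<open>m\<close> plays
    the absolute value of \<open>c\<close>, and \<open>v\<close> is twice its negative part.\<close>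
  have vv: "v * v = 2 *\<^sub>R (m * v)" and cv: "c * v = - (m * v)"
    using cm m(2) by (simp_all add: v_def algebra_simps scaleR_2)
  have vmv: "v * m * v = (k * v) * (k * v)" using vk k(2) by (metis mult.assoc)
  have "st (b * v) * (b * v) = v * (c * v)" using b v by (simp add: c_def mult.assoc)
  also have "\<dots> = - ((k * v) * (k * v))" using vmv cv by (simp add: mult.assoc)
  finally have "pos (- (st (b * v) * (b * v)))"
    using pos_square[of "k * v"] kB v vk by simp
  then have "b * v = 0" using eq_0_if_neg_st_mult_pos[of "b * v"] b v by simp
  then have "c * v = 0" by (simp add: c_def mult.assoc)
  then have "v * v * v = 0" using cv vv by simp
  then have "v = 0" using cube_eq_0 v by blast
  then show ?thesis using m(1) by (simp add: v_def c_def)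
qed

text \<open>Two roots need not commute a priori, so each is compared with the root \<open>m\<close>
  from \<open>pos_sqrt\<close>, which commutes with both. For \<open>d = x - m\<close> the positive
  elements \<open>d * x * d\<close> and \<open>d * m * d\<close> sum to 0, so both vanish, and their
  difference is the cube of \<open>d\<close>.\<close>

lemma pos_sqrt_unique:
  assumes "pos r" "pos s" "r * r = s * s" shows "r = s"
proof -
  obtain m where m: "pos m" "m * m = r * r"
    "\<And>z. \<lbrakk>z \<in> B; z * (r * r) = (r * r) * z\<rbrakk> \<Longrightarrow> z * m = m * z"
    using pos_sqrt pos_square assms pos_closed pos_sa by metis
  have eq: "x = m" if x: "pos x" "x * x = r * r" for x
  proof -
    have B: "x \<in> B" "st x = x" "m \<in> B" "st m = m" using x m pos_closed pos_sa by auto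
    have xm: "x * m = m * x" using m(3)[of x] B x(2) by (metis mult.assoc)
    define d where "d = x - m"
    have d: "d \<in> B" "st d = d" using B by (auto simp: d_def)
    have pos_d: "pos (d * z * d)" if z: "pos z" "d * z = z * d" for z
    proof -
      obtain k where k: "pos k" "k * k = z" "\<And>y. \<lbrakk>y \<in> B; y * z = z * y\<rbrakk> \<Longrightarrow> y * k = k * y"
        using pos_sqrt[OF z(1)] by blast
      have "d * k = k * d" using k(3)[of d] d z by simp
      then have "d * z * d = (k * d) * (k * d)" "st (k * d) = k * d"
        using k(2) pos_closed[OF k(1)] pos_sa[OF k(1)] d by (metis mult.assoc, simp)
      then show ?thesis using pos_square[of "k * d"] pos_closed[OF k(1)] d by simp
    qed
    have px: "pos (d * x * d)" and pm: "pos (d * m * d)"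
      using pos_d[OF x(1)] pos_d[OF m(1)] xm by (simp_all add: d_def left_diff_distrib right_diff_distrib)
    have "d * (x + m) = 0" using xm x(2) m(2) by (simp add: d_def algebra_simps)
    then have sum: "d * x * d + d * m * d = 0" by (metis distrib_left distrib_right mult_zero_left)
    then have "d * x * d = 0" "d * m * d = 0"
      using pos_add_eq_0[OF px pm] pos_add_eq_0[OF pm px] by (auto simp: add.commute)
    then have "d * d * d = 0" by (subst (2) d_def) (simp add: algebra_simps)
    then have "d = 0" using cube_eq_0 d by blast
    then show ?thesis by (simp add: d_def)
  qed
  show ?thesis using eq[of r] eq[of s] assms by simp
qed

subsection \<open>Idempotents\<close>

text \<open>The self-adjoint elements \<open>a * x\<close> and \<open>a * y\<close> absorb each
  other, hence agree; likewise \<open>x * a\<close> and \<open>y * a\<close>.\<close>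

lemma mp_inverse_unique:
  assumes B: "a \<in> B" "x \<in> B" "y \<in> B"
    and x: "a * x * a = a" "x * a * x = x" "st (a * x) = a * x" "st (x * a) = x * a"
    and y: "a * y * a = a" "y * a * y = y" "st (a * y) = a * y" "st (y * a) = y * a"
  shows "x = y"
proof -
  have "a * x = st (a * y * (a * x))" using x y B by (metis mult.assoc)
  also have "\<dots> = a * x * (a * y)" using B x(3) y(3) by (subst st_mult) auto
  also have "\<dots> = a * y" using x(1) by (metis mult.assoc)
  finally have ax: "a * x = a * y" .
  have "x * a = st (x * a * (y * a))" using x y B by (metis mult.assoc)
  also have "\<dots> = y * a * (x * a)" using B x(4) y(4) by (subst st_mult) auto
  also have "\<dots> = y * a" using x(1) by (metis mult.assoc)
  finally have xa: "x * a = y * a" .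
  show ?thesis using ax xa x(2) y(2) by (metis mult.assoc)
qed

lemma inverse_commute:
  "\<lbrakk>a * b = 1; b * a = 1; c * a = a * d\<rbrakk> \<Longrightarrow> b * c = d * (b::'b)"
  by (metis mult.assoc mult.left_neutral mult.right_neutral)

text \<open>The projection is \<open>q\<close> times the inverse of \<open>w = q + st q - 1\<close>.
  That inverse exists because \<open>w * w\<close> is 1 plus an element of the form
  \<open>st b * b\<close>.\<close>

lemma range_projection:
  assumes q: "q \<in> B" "q * q = q"
  obtains p where "p \<in> B" "st p = p" "p * p = p" "p * q = q" "q * p = p"
proof -
  define w where "w = q + st q - 1"
  have w: "w \<in> B" "st w = w" using q by (auto simp: w_def add.commute)
  have qq: "st q * st q = st q" using q st_mult[of q q] by simp
  have "w * w = 1 + st (q - st q) * (q - st q)"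
    using q qq by (simp add: w_def algebra_simps)
  then obtain y where y: "y \<in> B" "w * w * y = 1" "y * (w * w) = 1"
    using pos_one_plus_inverse[OF pos_st_mult[of "q - st q"]] q by auto
  define v where "v = w * y"
  have v: "v \<in> B" "w * v = 1" using w y by (auto simp: v_def mult.assoc)
  have "y * w = v"
  proof -
    have "y * w = y * w * (w * v)" using v by simp
    also have "\<dots> = v" using y by (metis mult.assoc mult.left_neutral)
    finally show ?thesis .
  qed
  then have vw: "v * w = 1" using y by (metis mult.assoc)
  have sv: "st v = v"
  proof -
    have "st v * w = 1" using st_mult[of w v] w v by simp
    then show ?thesis using v by (metis mult.assoc mult.left_neutral mult.right_neutral)
  qed
  \<comment> \<open>This intertwining passes to the inverse \<open>v\<close>, and makes
    \<open>q * v\<close> self-adjoint.\<close>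
  have wq: "w * q = st q * w" using q qq by (simp add: w_def algebra_simps)
  define p where "p = q * v"
  have p: "p = v * st q"
    using inverse_commute[OF v(2) vw, of "st q" q] wq by (simp add: p_def)
  have "st p = p" unfolding p using q v sv by (simp add: p[unfolded p_def])
  moreover have pq: "p * q = q"
  proof -
    have "p * q = v * (w * q)" unfolding p using q qq by (simp add: w_def algebra_simps)
    then show ?thesis using vw by (metis mult.assoc mult.left_neutral)
  qed
  moreover have "q * p = p" using q by (metis p_def mult.assoc)
  moreover have "p * p = p" using pq by (metis p_def mult.assoc)
  moreover have "p \<in> B" using q v by (simp add: p_def)
  ultimately show thesis using that by blast
qed

text \<open>The claim in algebraic form, with witnesses for the absolute value, its Moore-Penrose
  inverse and the inverse of \<open>s + 1\<close>. With \<open>f\<close> inverse to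
  \<open>1 + n * st n\<close>, both \<open>t * f\<close> and \<open>f * t\<close> equal
  \<open>p\<close>, so \<open>x = s * f\<close> satisfies \<open>s * x = x * s = p\<close>.\<close>

lemma idempotent_matched:
  assumes q: "q \<in> B" "q * q = q"
    and p: "p \<in> B" "st p = p" "p * p = p" "p * q = q" "q * p = p"
  obtains s e x where "pos s" "s * s = q * st q" "s * s = (2 *\<^sub>R p - q) * st (2 *\<^sub>R p - q)"
    "e \<in> B" "e * (s + 1) = 1" "(s + 1) * e = 1"
    "x \<in> B" "s * x * s = s" "x * s * x = x" "st (s * x) = s * x" "st (x * s) = x * s"
    "(1/2) *\<^sub>R ((s + st (2 *\<^sub>R p - q)) * x * e * (s + (2 *\<^sub>R p - q)))
      = (1/2) *\<^sub>R ((s + st q) * x * e * (s + q)) + (1 - st q) * x + x * (1 - q)"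
proof -
  define n where "n = q - p"
  have n: "n \<in> B" "p * n = n" "n * p = 0" "st n * p = st n" "p * st n = 0"
  proof -
    show n: "n \<in> B" "p * n = n" "n * p = 0" using q p by (auto simp: n_def algebra_simps)
    show "st n * p = st n" using st_mult[of p n] n p by simp
    have "st p * st n = st 0" using st_mult[of n p] n p by simp
    then show "p * st n = 0" using p st_scaleR[OF one_closed, of 0] by simp
  qed
  have qn: "q = p + n" by (simp add: n_def)
  have q'n: "2 *\<^sub>R p - q = p - n" by (simp add: n_def scaleR_2)
  define t where "t = p + n * st n"
  have t: "q * st q = t" "(2 *\<^sub>R p - q) * st (2 *\<^sub>R p - q) = t"
    unfolding q'n unfolding qn using n p by (simp_all add: t_def algebra_simps)
  have tB: "t \<in> B" using n p by (simp add: t_def)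
  have nn: "pos (n * st n)" using pos_st_mult[of "st n"] n by simp
  then obtain f where f: "f \<in> B" "(1 + n * st n) * f = 1" "f * (1 + n * st n) = 1"
    using pos_one_plus_inverse by blast
  have pnn: "p * (n * st n) = n * st n" "n * st n * p = n * st n"
    using n by (metis mult.assoc)+
  have pt: "p * t = t" "t * p = t" using pnn p by (auto simp: t_def algebra_simps)
  have t1: "t = p * (1 + n * st n)" "t = (1 + n * st n) * p"
    using pnn by (auto simp: t_def algebra_simps)
  have tf: "t * f = p" using f t1(1) by (simp add: mult.assoc)
  have ft: "f * t = p" using f t1(2) by (metis mult.assoc mult.left_neutral)
  have "pos (st (st q) * st q)" using pos_st_mult[of "st q"] q by simp
  then have "pos t" using q t by simp
  then obtain s where s: "pos s" "s * s = t"
    "\<And>z. \<lbrakk>z \<in> B; z * t = t * z\<rbrakk> \<Longrightarrow> z * s = s * z"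
    using pos_sqrt by blast
  have sB: "s \<in> B" "st s = s" using s pos_closed pos_sa by auto
  have fs: "f * s = s * f" using s(3)[of f] f tf ft by simp
  have ps: "p * s = s * p" using s(3)[of p] p pt by simp
  \<comment> \<open>The aim is \<open>p * s = s\<close>: the difference is self-adjoint, and its
    square vanishes since \<open>p\<close> is absorbed by \<open>t\<close>.\<close>
  have "s * (s * p) = t" using s(2) pt by (simp flip: mult.assoc)
  moreover from this have "s * (p * (s * p)) = t" using ps p(3) by (metis mult.assoc)
  ultimately have "(s - p * s) * st (s - p * s) = 0"
    using sB p ps s(2) pt by (simp add: algebra_simps)
  moreover have "st (s - p * s) = s - p * s" using sB p ps by simp
  ultimately have "s - p * s = 0" using square_eq_0[of "s - p * s"] sB p by simp
  then have ps': "p * s = s" "s * p = s" using ps by auto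
  define x where "x = s * f"
  have xB: "x \<in> B" using sB f by (simp add: x_def)
  have sx: "s * x = p" using s(2) tf by (simp add: x_def flip: mult.assoc)
  have xs: "x * s = p" using sx fs by (simp add: x_def mult.assoc)
  have px: "p * x = x" using ps' by (simp add: x_def flip: mult.assoc)
  have pf: "p * f = f * p"
    using tf ft by (metis f(1) fs mult.assoc inverse_commute[OF f(2,3), of p p] t1)
  have xp: "x * p = x" using px pf ps by (metis x_def mult.assoc)
  obtain e where e: "e \<in> B" "(1 + s) * e = 1" "e * (1 + s) = 1"
    using pos_one_plus_inverse[OF s(1)] by blast
  have ep: "e * p = p * e" by (rule inverse_commute[OF e(2,3)]) (simp add: ps algebra_simps)
  have "x * (1 + s) = (1 + s) * x" using sx xs by (simp add: algebra_simps)
  then have ex: "e * x = x * e" by (rule inverse_commute[OF e(2,3)])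
  \<comment> \<open>Here \<open>1 + s\<close> splits off and cancels against \<open>e\<close>; only
    the projection \<open>p\<close> remains, and \<open>x\<close> absorbs it.\<close>
  have sp: "s + p = (1 + s) * p" "s + p = p * (1 + s)" using ps' by (simp_all add: algebra_simps)
  have xesp: "x * e * (s + p) = x"
    unfolding sp(1) using e xp by (metis mult.assoc mult.left_neutral)
  have spxe: "(s + p) * (x * e) = x"
    unfolding sp(2) ex[symmetric] using e px by (metis mult.assoc mult.left_neutral)
  have eq: "(s + st (2 *\<^sub>R p - q)) * x * e * (s + (2 *\<^sub>R p - q))
      = (s + st q) * x * e * (s + q) + 2 *\<^sub>R ((1 - st q) * x + x * (1 - q))"
  proof -
    \<comment> \<open>In both expansions the terms with no or two factors from \<open>n\<close> and
      \<open>st n\<close> agree. The mixed ones differ in sign and reduce by \<open>G\<close> to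
      \<open>x * n\<close> and \<open>st n * x\<close>.\<close>
    define g where "g = x * e"
    have G: "g * (s + p) = x" "(s + p) * g = x" using xesp spxe by (auto simp: g_def)
    have l: "(s + st (2 *\<^sub>R p - q)) * x * e * (s + (2 *\<^sub>R p - q))
        = (s + p) * (g * (s + p)) - (s + p) * g * n - st n * (g * (s + p)) + st n * g * n"
      unfolding q'n using n p by (simp add: g_def algebra_simps)
    have r: "(s + st q) * x * e * (s + q)
        = (s + p) * (g * (s + p)) + (s + p) * g * n + st n * (g * (s + p)) + st n * g * n"
      unfolding qn using n p by (simp add: g_def algebra_simps)
    have "(1 - st q) * x = - (st n * x)" "x * (1 - q) = - (x * n)"
      unfolding qn using n p px xp by (simp_all add: algebra_simps)
    then show ?thesis unfolding l r unfolding G by (simp add: scaleR_2)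
  qed
  show thesis
  proof
    show "(1/2) *\<^sub>R ((s + st (2 *\<^sub>R p - q)) * x * e * (s + (2 *\<^sub>R p - q)))
      = (1/2) *\<^sub>R ((s + st q) * x * e * (s + q)) + (1 - st q) * x + x * (1 - q)"
      unfolding eq by (simp add: scaleR_add_right)
  qed (use s t e xB sx xs px ps' p in \<open>simp_all add: add.commute\<close>)
qed

end

section \<open>The C*-algebra of adjointable operators\<close>

lemma cscale_zero [simp]: "cscale c (0::'m::complex_vs) = 0"
  using cscale_add_right[of c "0::'m" 0] by simp

lemma cscale_one [simp]: "cscale 1 (x::'m::complex_vs) = x"
  using cscale_of_real[of 1 x] by simp

lemma cscale_minus_one: "cscale (- 1) (x::'m::complex_vs) = - x"
  using cscale_of_real[of "- 1" x] by simp

lemma cscale_minus_right: "cscale c (- x) = - cscale c (x::'m::complex_vs)"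
  using cscale_cscale[of c "-1" x] cscale_cscale[of "-1" c x] by (simp add: cscale_minus_one)

lemma cscale_diff_right: "cscale c (x - y) = cscale c x - cscale c (y::'m::complex_vs)"
  using cscale_add_right[of c x "- y"] by (simp add: cscale_minus_right)

lemma cscale_scaleR: "cscale c (r *\<^sub>R x) = r *\<^sub>R cscale c (x::'m::complex_vs)"
  by (simp flip: cscale_of_real add: cscale_cscale mult.commute)

lemma norm_cstar [simp]: "norm (cstar x) = norm (x::'a::cstar_algebra)"
proof -
  have le: "norm y \<le> norm (cstar y)" for y :: 'a
  proof (cases "y = 0")
    case False
    have "norm y * norm y \<le> norm (cstar y) * norm y"
      using cstar_identity[of y] norm_mult_ineq[of "cstar y" y] by (simp add: power2_eq_square)
    with False show ?thesis by simp
  qed simp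
  show ?thesis using le[of x] le[of "cstar x"] by (simp add: cstar_cstar)
qed

text \<open>Composition distributes over sums on both sides only for additive maps; a type of linear
  maps therefore carries the algebra classes, and every adjointable map belongs to it.\<close>

typedef (overloaded) 'm clin =
  "{f :: 'm::complex_vs \<Rightarrow> 'm. (\<forall>x y. f (x + y) = f x + f y) \<and> (\<forall>c x. f (cscale c x) = cscale c (f x))}"
  morphisms app Clin
  by (rule exI[of _ id]) simp

setup_lifting type_definition_clin

lemma app_add: "app f (x + y) = app f x + app f y"
  and app_cscale: "app f (cscale c x) = cscale c (app f x)"
  using app[of f] by auto

lemma app_scaleR: "app f (r *\<^sub>R x) = r *\<^sub>R app f x"
  by (simp flip: cscale_of_real add: app_cscale)

lemma app_zero: "app f 0 = 0"
  using app_scaleR[of f 0 0] by simp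

instantiation clin :: (complex_vs) "{real_algebra, monoid_mult}"
begin

lift_definition zero_clin :: "'a clin" is "\<lambda>x. 0" by simp
lift_definition one_clin :: "'a clin" is "id" by simp
lift_definition plus_clin :: "'a clin \<Rightarrow> 'a clin \<Rightarrow> 'a clin" is op_add
  by (simp add: op_add_def cscale_add_right)
lift_definition minus_clin :: "'a clin \<Rightarrow> 'a clin \<Rightarrow> 'a clin" is op_diff
  by (simp add: op_diff_def cscale_diff_right)
lift_definition uminus_clin :: "'a clin \<Rightarrow> 'a clin" is "\<lambda>f x. - f x"
  by (simp add: cscale_minus_right)
lift_definition times_clin :: "'a clin \<Rightarrow> 'a clin \<Rightarrow> 'a clin" is "(\<circ>)" by simp
lift_definition scaleR_clin :: "real \<Rightarrow> 'a clin \<Rightarrow> 'a clin" is op_scale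
  by (simp add: op_scale_def scaleR_add_right cscale_scaleR)

lemmas app_simps = plus_clin.rep_eq minus_clin.rep_eq times_clin.rep_eq scaleR_clin.rep_eq
  one_clin.rep_eq zero_clin.rep_eq uminus_clin.rep_eq

instance
proof
  fix a b c :: "'a clin" and r s :: real
  show "a + b + c = a + (b + c)" "a + b = b + a" "0 + a = a" "- a + a = 0" "a - b = a + - b"
    "r *\<^sub>R (a + b) = r *\<^sub>R a + r *\<^sub>R b" "(r + s) *\<^sub>R a = r *\<^sub>R a + s *\<^sub>R a"
    "r *\<^sub>R s *\<^sub>R a = (r * s) *\<^sub>R a" "1 *\<^sub>R a = a"
    "a * b * c = a * (b * c)" "1 * a = a" "a * 1 = a"
    "(a + b) * c = a * c + b * c" "a * (b + c) = a * b + a * c"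
    "r *\<^sub>R a * b = r *\<^sub>R (a * b)" "a * r *\<^sub>R b = r *\<^sub>R (a * b)"
    by (simp_all add: app_inject[symmetric] app_simps op_add_def op_diff_def op_scale_def fun_eq_iff
        app_add app_scaleR scaleR_add_left scaleR_add_right)
qed

end

lift_definition imag_clin :: "'m::complex_vs clin" is "cscale \<i>"
  by (simp add: cscale_add_right cscale_cscale mult.commute)

section \<open>Inner products and the module norm\<close>

locale sesquilinear_definite =
  fixes ip :: "'m::complex_vs \<Rightarrow> 'm \<Rightarrow> 'a::cstar_algebra"
  assumes ip_add_right: "ip x (y + z) = ip x y + ip x z"
    and ip_cscale_right: "ip x (cscale c y) = cscale c (ip x y)"
    and ip_sym: "ip y x = cstar (ip x y)"
    and ip_definite: "ip x x = 0 \<Longrightarrow> x = 0"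
begin

abbreviation hn :: "'m \<Rightarrow> real" where "hn \<equiv> hmod_norm ip"

lemma ip_add_left: "ip (x + y) z = ip x z + ip y z"
  by (metis ip_add_right ip_sym cstar_add)

lemma ip_cscale_left: "ip (cscale c x) y = cscale (cnj c) (ip x y)"
  by (metis ip_cscale_right ip_sym cstar_cscale)

lemma ip_scaleR_right: "ip x (r *\<^sub>R y) = r *\<^sub>R ip x y"
  by (metis ip_cscale_right cscale_of_real)

lemma ip_scaleR_left: "ip (r *\<^sub>R x) y = r *\<^sub>R ip x y"
  by (metis ip_cscale_left cscale_of_real complex_cnj_complex_of_real)

lemma ip_diff_right: "ip x (y - z) = ip x y - ip x z"
  using ip_add_right[of x "y - z" z] by simp

lemma ip_diff_left: "ip (x - y) z = ip x z - ip y z"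
  using ip_add_left[of "x - y" y z] by simp

lemma ip_right_eqI: "(\<And>z. ip z x = ip z y) \<Longrightarrow> x = y"
  using ip_definite[of "x - y"] by (simp add: ip_diff_right)

lemma hn_nonneg [simp]: "0 \<le> hn x"
  by (simp add: hmod_norm_def)

lemma hn_square: "(hn x)\<^sup>2 = norm (ip x x)"
  by (simp add: hmod_norm_def)

lemma hn_eq_0 [simp]: "hn x = 0 \<longleftrightarrow> x = 0"
  using ip_definite[of x] ip_scaleR_right[of 0 0 0] by (auto simp: hmod_norm_def)

lemma hn_zero [simp]: "hn 0 = 0"
  by simp

lemma hn_cscale: "hn (cscale c x) = cmod c * hn x"
  by (simp add: hmod_norm_def ip_cscale_left ip_cscale_right norm_cscale real_sqrt_mult)

lemma hn_scaleR: "hn (r *\<^sub>R x) = \<bar>r\<bar> * hn x"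
  using hn_cscale[of "complex_of_real r" x] by (simp add: cscale_of_real)

end

text \<open>Cauchy-Schwarz is an axiom here to break a circle: for modules it is derived from the
  operator algebra that this locale builds over the coefficient algebra.\<close>

locale complete_inner = sesquilinear_definite ip
  for ip :: "'m::complex_vs \<Rightarrow> 'm \<Rightarrow> 'a::cstar_algebra" +
  assumes cauchy_schwarz: "norm (ip x y) \<le> hmod_norm ip x * hmod_norm ip y"
    and hmod_complete: "\<forall>e>0. \<exists>M. \<forall>m\<ge>M. \<forall>n\<ge>M. hmod_norm ip (f m - f n) < e
        \<Longrightarrow> \<exists>x. (\<lambda>n::nat. hmod_norm ip (f n - x)) \<longlonglongrightarrow> 0"
begin

lemma hn_minus: "hn (- x) = hn x"
  using hn_scaleR[of "-1" x] by simp

lemma hn_diff_commute: "hn (x - y) = hn (y - x)"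
  using hn_minus[of "x - y"] by simp

lemma hn_triangle: "hn (x + y) \<le> hn x + hn y"
proof (rule power2_le_imp_le)
  have "(hn (x + y))\<^sup>2 = norm (ip x x + ip x y + (ip y x + ip y y))"
    by (simp add: hn_square ip_add_left ip_add_right add_ac)
  also have "\<dots> \<le> norm (ip x x) + norm (ip x y) + (norm (ip y x) + norm (ip y y))"
    by (intro norm_triangle_mono order_refl)
  also have "\<dots> \<le> (hn x + hn y)\<^sup>2"
    using cauchy_schwarz[of x y] cauchy_schwarz[of y x] 
    by (simp add: power2_sum mult.commute[of "hn y" "hn x"] flip: hn_square)
  finally show "(hn (x + y))\<^sup>2 \<le> (hn x + hn y)\<^sup>2" .
qed simp

lemma hn_triangle_diff: "hn (x - z) \<le> hn (x - y) + hn (y - z)"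
  using hn_triangle[of "x - y" "y - z"] by simp

lemma hn_le_if_ip_le:
  assumes "0 \<le> K" "\<And>y. norm (ip x y) \<le> K * hn y" shows "hn x \<le> K"
proof (cases "hn x = 0")
  case False
  have "hn x * hn x \<le> K * hn x" using assms(2)[of x] hn_square[of x] by (simp add: power2_eq_square)
  then show ?thesis using False hn_nonneg[of x] by (simp add: less_le)
qed (use assms in simp)

lemma ip_tendsto_left:
  assumes "(\<lambda>n. hn (f n - x)) \<longlonglongrightarrow> 0" shows "(\<lambda>n. ip (f n) y) \<longlonglongrightarrow> ip x y"
proof -
  have "(\<lambda>n. hn (f n - x) * hn y) \<longlonglongrightarrow> 0" using tendsto_mult_right[OF assms, of "hn y"] by simp
  then have "(\<lambda>n. ip (f n) y - ip x y) \<longlonglongrightarrow> 0"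
    by (rule Lim_null_comparison[rotated]) (simp add: cauchy_schwarz flip: ip_diff_left)
  then show ?thesis by (simp add: LIM_zero_iff)
qed

lemma ip_tendsto_right:
  assumes "(\<lambda>n. hn (f n - x)) \<longlonglongrightarrow> 0" shows "(\<lambda>n. ip y (f n)) \<longlonglongrightarrow> ip y x"
proof -
  have "(\<lambda>n. hn y * hn (f n - x)) \<longlonglongrightarrow> 0" using tendsto_mult_left[OF assms, of "hn y"] by simp
  then have "(\<lambda>n. ip y (f n) - ip y x) \<longlonglongrightarrow> 0"
    by (rule Lim_null_comparison[rotated]) (simp add: cauchy_schwarz flip: ip_diff_right)
  then show ?thesis by (simp add: LIM_zero_iff)
qed

section \<open>Adjoints and automatic boundedness\<close>

lemma adj_eqI: "(\<And>x y. ip (T x) y = ip x (S y)) \<Longrightarrow> adj ip T = S"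
  unfolding adj_def by (rule the_equality) (auto intro!: ext ip_right_eqI)

lemma adjointableI: "(\<And>x y. ip (T x) y = ip x (S y)) \<Longrightarrow> adjointable ip T"
  by (auto simp: adjointable_def)

lemma ip_adj: "adjointable ip T \<Longrightarrow> ip (T x) y = ip x (adj ip T y)"
  using adj_eqI by (metis adjointable_def)

lemma ip_adj': "adjointable ip T \<Longrightarrow> ip (adj ip T x) y = ip x (T y)"
  by (metis ip_adj ip_sym)

lemma adjointable_clin:
  assumes "adjointable ip T" obtains a where "T = app a"
proof -
  have "T (x + y) = T x + T y" for x y
    by (rule ip_right_eqI) (simp add: ip_add_right flip: ip_adj'[OF assms])
  moreover have "T (cscale c x) = cscale c (T x)" for c x
    by (rule ip_right_eqI) (simp add: ip_cscale_right flip: ip_adj'[OF assms])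
  ultimately show thesis using that[of "Clin T"] by (simp add: Clin_inverse)
qed

text \<open>Hellinger--Toeplitz: Baire's theorem for the sets on which \<open>\<langle>x, T\<^sup>* y\<rangle>\<close>, \<open>y\<close> in the unit ball,
  is bounded by a given integer.\<close>

lemma adjointable_bounded:
  assumes "adjointable ip (app a)"
  obtains K where "0 \<le> K" "\<And>x. hn (app a x) \<le> K * hn x"
proof -
  define S where "S = adj ip (app a)"
  have S: "ip (app a x) y = ip x (S y)" for x y using ip_adj assms by (simp add: S_def)
  interpret M: Metric_space UNIV "\<lambda>x y. hn (x - y)"
    by standard (auto simp: hn_diff_commute intro: hn_triangle_diff)
  have compl: "M.mcomplete"
    unfolding M.mcomplete_def M.MCauchy_def M.limitin_metric_dist_null
    using hmod_complete by simp
  define F where "F n = {x. \<forall>y. hn y \<le> 1 \<longrightarrow> norm (ip x (S y)) \<le> real n}" for n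
  have closed: "closedin M.mtopology (F n)" for n
    unfolding M.closedin_metric
  proof (intro conjI allI impI)
    fix x assume "x \<in> UNIV - F n"
    then obtain y where y: "hn y \<le> 1" "real n < norm (ip x (S y))" by (auto simp: F_def not_le)
    \<comment> \<open>The slack of a violated bound, divided by the Lipschitz constant of the
      pairing with \<open>S y\<close>; adding 1 avoids division by 0.\<close>
    define r where "r = (norm (ip x (S y)) - real n) / (hn (S y) + 1)"
    have h: "0 < hn (S y) + 1" by (simp add: add_nonneg_pos)
    have r: "0 < r" using y h by (simp add: r_def)
    have "x' \<notin> F n" if "hn (x - x') < r" for x'
    proof -
      have "norm (ip x (S y)) - norm (ip x' (S y)) \<le> norm (ip (x - x') (S y))"
        by (simp add: ip_diff_left norm_triangle_ineq2)
      also have "\<dots> \<le> hn (x - x') * hn (S y)" by (rule cauchy_schwarz)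
      also have "\<dots> \<le> r * hn (S y)" using that by (intro mult_right_mono) auto
      also have "\<dots> < r * (hn (S y) + 1)" using r by simp
      also have "\<dots> = norm (ip x (S y)) - real n" using h by (simp add: r_def)
      finally have "real n < norm (ip x' (S y))" by simp
      then show ?thesis using y(1) by (auto simp: F_def not_le)
    qed
    then show "\<exists>r>0. disjnt (F n) (M.mball x r)"
      using r by (auto simp: disjnt_def M.mball_def)
  qed simp
  have "x \<in> (\<Union>n. F n)" for x
  proof -
    have "norm (ip x (S y)) \<le> hn (app a x)" if "hn y \<le> 1" for y
      using cauchy_schwarz[of "app a x" y] that mult_left_mono[OF that, of "hn (app a x)"]
      by (simp add: S)
    moreover obtain n where "hn (app a x) \<le> real n" using real_arch_simple by blast
    ultimately show ?thesis unfolding F_def by (auto intro: order_trans)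
  qed
  then have UF: "\<Union>(range F) = UNIV" by auto
  have "\<exists>n. M.mtopology interior_of F n \<noteq> {}"
  proof (rule ccontr)
    assume "\<not> ?thesis"
    then have "M.mtopology interior_of \<Union>(range F) = {}"
      using compl closed by (intro M.metric_Baire_category_alt) auto
    moreover have "0 \<in> M.mtopology interior_of \<Union>(range F)"
      unfolding UF M.in_interior_of_mball using zero_less_one by blast
    ultimately show False by simp
  qed
  then obtain n x0 r where r: "0 < r" "M.mcball x0 r \<subseteq> F n"
    unfolding M.in_interior_of_mcball by (metis M.in_interior_of_mcball ex_in_conv)
  have F_bound: "hn (app a x) \<le> real n" if "x \<in> F n" for x
  proof (rule hn_le_if_ip_le)
    fix y
    show "norm (ip (app a x) y) \<le> real n * hn y"
    proof (cases "y = 0")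
      case True
      then show ?thesis using cauchy_schwarz[of "app a x" 0] by simp
    next
      case False
      then have hy: "0 < hn y" by (simp add: less_le)
      define z where "z = (1 / hn y) *\<^sub>R y"
      have "hn z \<le> 1" using hy by (simp add: z_def hn_scaleR)
      then have "norm (ip (app a x) z) \<le> real n" using that by (simp add: F_def S)
      then show ?thesis using hy by (simp add: z_def ip_scaleR_right pos_divide_le_eq)
    qed
  qed simp
  show thesis
  proof (rule that[of "2 * real n / r"])
    fix x
    show "hn (app a x) \<le> 2 * real n / r * hn x"
    proof (cases "x = 0")
      case False
      then have hx: "0 < hn x" by (simp add: less_le)
      \<comment> \<open>\<open>x\<close> is rescaled to length \<open>r\<close>, so that
        \<open>x0\<close> and \<open>x0 + z\<close> both lie in the closed ball; the bound for
        \<open>z\<close> follows by subtraction, whence \<open>2 n / r\<close>.\<close>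
      define z where "z = (r / hn x) *\<^sub>R x"
      have "hn z = r" using hx r False by (simp add: z_def hn_scaleR)
      then have "x0 \<in> F n" "x0 + z \<in> F n"
        using r hn_minus[of z] by (auto simp: M.mcball_def)
      then have "hn (app a (x0 + z)) + hn (app a x0) \<le> 2 * real n"
        using F_bound[of x0] F_bound[of "x0 + z"] by simp
      moreover have "hn (app a z) \<le> hn (app a (x0 + z)) + hn (app a x0)"
        using hn_triangle[of "app a (x0 + z)" "- app a x0"] by (simp add: app_add hn_minus)
      ultimately have "(r / hn x) * hn (app a x) \<le> 2 * real n"
        using r hx by (simp add: z_def app_scaleR hn_scaleR)
      then show ?thesis using r hx by (simp add: field_simps)
    qed (simp add: app_zero)
  qed (use r in simp)
qed

section \<open>The operator norm and the C*-axioms\<close>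

definition Adj :: "'m clin set" where "Adj = {a. adjointable ip (app a)}"

definition star :: "'m clin \<Rightarrow> 'm clin" where "star a = Clin (adj ip (app a))"

text \<open>An infimum of bounds rather than a supremum over unit vectors, of which the zero module
  has none.\<close>

definition opn :: "'m clin \<Rightarrow> real" where
  "opn a = Inf {K. 0 \<le> K \<and> (\<forall>x. hn (app a x) \<le> K * hn x)}"

lemma AdjI: "(\<And>x y. ip (app a x) y = ip x (app b y)) \<Longrightarrow> a \<in> Adj"
  by (auto simp: Adj_def adjointable_def)

lemma app_star: assumes "a \<in> Adj" shows "app (star a) = adj ip (app a)"
proof -
  have "adjointable ip (adj ip (app a))"
    by (rule adjointableI, rule ip_adj') (use assms in \<open>simp add: Adj_def\<close>)
  then obtain b where "adj ip (app a) = app b" by (rule adjointable_clin)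
  then show ?thesis by (simp add: star_def app_inverse)
qed

lemma ip_star: "a \<in> Adj \<Longrightarrow> ip (app a x) y = ip x (app (star a) y)"
  using ip_adj by (simp add: Adj_def app_star)

lemma ip_star': "a \<in> Adj \<Longrightarrow> ip (app (star a) x) y = ip x (app a y)"
  using ip_adj' by (simp add: Adj_def app_star)

lemma star_eqI: "(\<And>x y. ip (app a x) y = ip x (app b y)) \<Longrightarrow> star a = b"
  unfolding star_def by (subst adj_eqI) (auto simp: app_inverse)

lemma opn_bound: assumes "a \<in> Adj" shows "hn (app a x) \<le> opn a * hn x"
proof (cases "x = 0")
  case False
  then have hx: "0 < hn x" by (simp add: less_le)
  obtain K where "0 \<le> K" "\<And>x. hn (app a x) \<le> K * hn x"
    using adjointable_bounded assms unfolding Adj_def by blast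
  then have "hn (app a x) / hn x \<le> opn a"
    unfolding opn_def using hx by (intro cInf_greatest) (auto simp: pos_divide_le_eq)
  then show ?thesis using hx by (simp add: pos_divide_le_eq)
qed (simp add: app_zero)

lemma opn_le: "\<lbrakk>0 \<le> K; \<And>x. hn (app a x) \<le> K * hn x\<rbrakk> \<Longrightarrow> opn a \<le> K"
  unfolding opn_def by (intro cInf_lower bdd_belowI[of _ 0]) auto

lemma opn_nonneg: assumes "a \<in> Adj" shows "0 \<le> opn a"
proof -
  obtain K where "0 \<le> K" "\<And>x. hn (app a x) \<le> K * hn x"
    using adjointable_bounded assms unfolding Adj_def by blast
  then show ?thesis unfolding opn_def by (intro cInf_greatest) auto
qed

lemma opn_mult: assumes "a \<in> Adj" "b \<in> Adj" shows "opn (a * b) \<le> opn a * opn b"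
proof (rule opn_le)
  fix x
  have "hn (app a (app b x)) \<le> opn a * hn (app b x)" by (rule opn_bound[OF assms(1)])
  also have "\<dots> \<le> opn a * (opn b * hn x)"
    by (intro mult_left_mono opn_bound opn_nonneg assms)
  finally show "hn (app (a * b) x) \<le> opn a * opn b * hn x" by (simp add: app_simps mult.assoc)
qed (simp add: assms opn_nonneg)

lemma star_Adj: "a \<in> Adj \<Longrightarrow> star a \<in> Adj"
  by (rule AdjI[of _ a]) (rule ip_star')

lemma opn_square_le: assumes a: "a \<in> Adj" and aa: "star a * a \<in> Adj"
  shows "(opn a)\<^sup>2 \<le> opn (star a * a)"
proof -
  have "opn a \<le> sqrt (opn (star a * a))"
  proof (rule opn_le)
    fix x
    have "(hn (app a x))\<^sup>2 = norm (ip x (app (star a * a) x))"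
      by (simp add: hn_square ip_star[OF a] app_simps)
    also have "\<dots> \<le> hn x * hn (app (star a * a) x)" by (rule cauchy_schwarz)
    also have "\<dots> \<le> hn x * (opn (star a * a) * hn x)"
      by (intro mult_left_mono opn_bound aa) simp
    finally have "(hn (app a x))\<^sup>2 \<le> opn (star a * a) * (hn x)\<^sup>2"
      by (simp add: power2_eq_square mult_ac)
    then have "hn (app a x) \<le> sqrt (opn (star a * a) * (hn x)\<^sup>2)" by (rule real_le_rsqrt)
    then show "hn (app a x) \<le> sqrt (opn (star a * a)) * hn x" by (simp add: real_sqrt_mult)
  qed (simp add: opn_nonneg aa)
  then show ?thesis using opn_nonneg[OF a] opn_nonneg[OF aa]
    by (metis power_mono real_sqrt_pow2)
qed

text \<open>Pointwise limits of \<open>f n\<close> and of \<open>star (f n)\<close> both exist, and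
  continuity of the inner product makes them adjoint to each other. The closure facts are hypotheses
  because they are established only inside the sublocale proof that calls this lemma.\<close>

lemma Adj_complete:
  assumes f: "\<And>n::nat. f n \<in> Adj" "\<And>m n. f m - f n \<in> Adj"
    and cauchy: "\<forall>e>0. \<exists>M. \<forall>m\<ge>M. \<forall>n\<ge>M. opn (f m - f n) < e"
    and star_cauchy: "\<And>m n. opn (star (f m) - star (f n)) \<le> opn (f m - f n)"
      "\<And>m n. star (f m) - star (f n) \<in> Adj"
  shows "\<exists>a\<in>Adj. (\<lambda>n. opn (f n - a)) \<longlonglongrightarrow> 0"
proof -
  have lim: "\<exists>y. (\<lambda>n. hn (app (g n) x - y)) \<longlonglongrightarrow> 0"
    if g: "\<And>m n. g m - g n \<in> Adj" "\<And>m n. opn (g m - g n) \<le> opn (f m - f n)" for g x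
  proof (rule hmod_complete, intro allI impI)
    fix e :: real assume "0 < e"
    then have "0 < e / (hn x + 1)" by (simp add: add_nonneg_pos)
    then obtain M where M: "\<And>m n. \<lbrakk>m \<ge> M; n \<ge> M\<rbrakk> \<Longrightarrow> opn (f m - f n) < e / (hn x + 1)"
      using cauchy by meson
    have "hn (app (g m) x - app (g n) x) < e" if "m \<ge> M" "n \<ge> M" for m n
    proof -
      have "hn (app (g m) x - app (g n) x) \<le> opn (g m - g n) * hn x"
        using opn_bound[OF g(1)[of m n], of x] by (simp add: app_simps op_diff_def)
      also have "\<dots> \<le> e / (hn x + 1) * hn x"
        using M[OF that] g(2)[of m n] by (intro mult_right_mono) auto
      also have "\<dots> < e"
        using \<open>0 < e\<close> hn_nonneg[of x] by (simp add: pos_divide_less_eq add_nonneg_pos)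
      finally show ?thesis .
    qed
    then show "\<exists>M. \<forall>m\<ge>M. \<forall>n\<ge>M. hn (app (g m) x - app (g n) x) < e" by blast
  qed
  have "\<forall>x. \<exists>y. (\<lambda>n. hn (app (f n) x - y)) \<longlonglongrightarrow> 0"
    by (intro allI lim f(2) order_refl)
  then obtain T where T: "\<And>x. (\<lambda>n. hn (app (f n) x - T x)) \<longlonglongrightarrow> 0"
    by (auto dest!: choice)
  have "\<forall>x. \<exists>y. (\<lambda>n. hn (app (star (f n)) x - y)) \<longlonglongrightarrow> 0"
    by (intro allI lim star_cauchy)
  then obtain S where S: "\<And>x. (\<lambda>n. hn (app (star (f n)) x - S x)) \<longlonglongrightarrow> 0"
    by (auto dest!: choice)
  have adj: "ip (T x) y = ip x (S y)" for x y
    using LIMSEQ_unique[OF ip_tendsto_left[OF T[of x], of y]] ip_tendsto_right[OF S[of y], of x]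
      ip_star[OF f(1)] by simp
  then obtain a where a: "T = app a" using adjointable_clin[OF adjointableI] by blast
  have "a \<in> Adj" using adj by (auto simp: Adj_def a intro: adjointableI)
  moreover have "(\<lambda>n. opn (f n - a)) \<longlonglongrightarrow> 0"
  proof (rule LIMSEQ_I)
    fix e :: real assume "0 < e"
    then obtain M where M: "\<And>m n. \<lbrakk>m \<ge> M; n \<ge> M\<rbrakk> \<Longrightarrow> opn (f m - f n) < e / 2"
      using cauchy half_gt_zero by meson
    have "opn (f n - a) \<le> e / 2" if n: "n \<ge> M" for n
    proof (rule opn_le)
      fix x
      have "(\<lambda>m. e / 2 * hn x + hn (app (f m) x - T x)) \<longlonglongrightarrow> e / 2 * hn x + 0"
        by (intro tendsto_intros T)
      \<comment> \<open>The last term depends on \<open>x\<close> but vanishes as \<open>m\<close>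
        grows with \<open>n\<close> fixed, leaving a bound uniform in \<open>x\<close>. The limit
        preserves only a weak inequality, hence \<open>e / 2\<close>.\<close>
      moreover have "\<forall>m\<ge>M. hn (app (f n) x - T x) \<le> e / 2 * hn x + hn (app (f m) x - T x)"
      proof (intro allI impI)
        fix m assume m: "m \<ge> M"
        have "hn (app (f n) x - app (f m) x) \<le> opn (f n - f m) * hn x"
          using opn_bound[OF f(2)[of n m], of x] by (simp add: app_simps op_diff_def)
        also have "\<dots> \<le> e / 2 * hn x" using M[OF n m] by (intro mult_right_mono) auto
        finally show "hn (app (f n) x - T x) \<le> e / 2 * hn x + hn (app (f m) x - T x)"
          using hn_triangle_diff[of "app (f n) x" "T x" "app (f m) x"] by linarith
      qed
      ultimately have "hn (app (f n) x - T x) \<le> e / 2 * hn x + 0"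
        by (intro LIMSEQ_le_const) auto
      then show "hn (app (f n - a) x) \<le> e / 2 * hn x" by (simp add: app_simps op_diff_def a)
    qed (use \<open>0 < e\<close> in simp)
    moreover have "0 \<le> opn (f n - a)" for n
    proof (rule opn_nonneg, rule AdjI[of _ "star (f n) - star a"])
      show "ip (app (f n - a) x) y = ip x (app (star (f n) - star a) y)" for x y
        using \<open>a \<in> Adj\<close> f(1) by (simp add: app_simps op_diff_def ip_diff_left ip_diff_right ip_star)
    qed
    ultimately show "\<exists>M. \<forall>n\<ge>M. norm (opn (f n - a) - 0) < e"
      using \<open>0 < e\<close> by (intro exI[of _ M]) (force simp: abs_of_nonneg)
  qed
  ultimately show ?thesis by blast
qed

sublocale L: unital_cstar Adj star opn imag_clin
proof
  have add: "a + b \<in> Adj \<and> star (a + b) = star a + star b" if "a \<in> Adj" "b \<in> Adj" for a b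
    using that
    by (auto intro!: AdjI[of _ "star a + star b"] star_eqI
        simp: app_simps op_add_def ip_add_left ip_add_right ip_star)
  have diff: "a - b \<in> Adj \<and> star (a - b) = star a - star b" if "a \<in> Adj" "b \<in> Adj" for a b
    using that
    by (auto intro!: AdjI[of _ "star a - star b"] star_eqI
        simp: app_simps op_diff_def ip_diff_left ip_diff_right ip_star)
  have mult: "a * b \<in> Adj \<and> star (a * b) = star b * star a" if "a \<in> Adj" "b \<in> Adj" for a b
    using that
    by (auto intro!: AdjI[of _ "star b * star a"] star_eqI simp: app_simps ip_star)
  have scale: "r *\<^sub>R a \<in> Adj \<and> star (r *\<^sub>R a) = r *\<^sub>R star a" if "a \<in> Adj" for a r
    using that
    by (auto intro!: AdjI[of _ "r *\<^sub>R star a"] star_eqI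
        simp: app_simps op_scale_def ip_scaleR_left ip_scaleR_right ip_star)
  have star_star: "star (star a) = a" if "a \<in> Adj" for a
    using that by (intro star_eqI) (simp add: ip_star')
  have opn_star_le: "opn a \<le> opn (star a)" if a: "a \<in> Adj" for a
  proof (cases "opn a = 0")
    case True
    then show ?thesis using opn_nonneg[OF star_Adj[OF a]] by simp
  next
    case False
    have "opn a * opn a \<le> opn (star a) * opn a"
      using opn_square_le[OF a] mult[OF star_Adj[OF a] a] opn_mult[OF star_Adj[OF a] a]
      by (simp add: power2_eq_square)
    then show ?thesis using False opn_nonneg[OF a] by (simp add: less_le)
  qed
  have opn_star: "opn (star a) = opn a" if "a \<in> Adj" for a
    using opn_star_le[OF that] opn_star_le[OF star_Adj[OF that]] star_star[OF that] by simp
  have scale_le: "opn (r *\<^sub>R a) \<le> \<bar>r\<bar> * opn a" if "a \<in> Adj" for a r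
  proof (rule opn_le)
    fix x
    have "\<bar>r\<bar> * hn (app a x) \<le> \<bar>r\<bar> * (opn a * hn x)"
      by (intro mult_left_mono opn_bound that) simp
    then show "hn (app (r *\<^sub>R a) x) \<le> \<bar>r\<bar> * opn a * hn x"
      by (simp add: app_simps op_scale_def hn_scaleR mult.assoc)
  qed (simp add: opn_nonneg that)
  fix x y :: "'m clin" and r :: real
  show "1 \<in> Adj" by (rule AdjI[of _ 1]) (simp add: app_simps)
  {
    assume x: "x \<in> Adj"
    show "r *\<^sub>R x \<in> Adj" "star (r *\<^sub>R x) = r *\<^sub>R star x" using scale x by auto
    show "star x \<in> Adj" "star (star x) = x" using star_Adj star_star x by auto
    show "x = 0" if "opn x = 0"
    proof -
      have "hn (app x z) \<le> 0" for z using opn_bound[OF x, of z] that by simp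
      then have "app x z = 0" for z using hn_eq_0[of "app x z"] hn_nonneg[of "app x z"] by (metis antisym)
      then show ?thesis by transfer auto
    qed
    show "opn (r *\<^sub>R x) = \<bar>r\<bar> * opn x"
    proof (rule antisym[OF scale_le[OF x]])
      show "\<bar>r\<bar> * opn x \<le> opn (r *\<^sub>R x)"
      proof (cases "r = 0")
        case True
        then show ?thesis using opn_nonneg[of "r *\<^sub>R x"] scale[OF x, of r] by simp
      next
        case False
        then have "opn x \<le> \<bar>1 / r\<bar> * opn (r *\<^sub>R x)"
          using scale_le[of "r *\<^sub>R x" "1 / r"] scale[OF x, of r] by simp
        then show ?thesis using False by (simp add: field_simps)
      qed
    qed
    show "opn (star x * x) = (opn x)\<^sup>2"
      using opn_square_le[OF x] mult[OF star_Adj[OF x] x] opn_mult[OF star_Adj[OF x] x]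
        opn_star[OF x] by (simp add: power2_eq_square)
    show "x * imag_clin = imag_clin * x"
      by (transfer) (auto simp: fun_eq_iff)
    assume y: "y \<in> Adj"
    show "x + y \<in> Adj" "star (x + y) = star x + star y" using add x y by auto
    show "x * y \<in> Adj" "star (x * y) = star y * star x" using mult x y by auto
    show "opn (x * y) \<le> opn x * opn y" using opn_mult x y by blast
    show "opn (x + y) \<le> opn x + opn y"
    proof (rule opn_le)
      fix z
      show "hn (app (x + y) z) \<le> (opn x + opn y) * hn z"
        using hn_triangle[of "app x z" "app y z"] opn_bound[OF x, of z] opn_bound[OF y, of z]
        by (simp add: app_simps op_add_def distrib_right)
    qed (simp add: opn_nonneg x y)
  }
  have imag: "ip (app imag_clin z) w = ip z (app (- imag_clin) w)" for z w
    by (simp add: imag_clin.rep_eq app_simps ip_cscale_left flip: cscale_minus_one)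
      (simp add: cscale_cscale ip_cscale_right)
  show "imag_clin \<in> Adj" using imag by (rule AdjI)
  show "star imag_clin = - imag_clin" using imag by (rule star_eqI)
  show "imag_clin * imag_clin = (- 1 :: 'm clin)"
    by transfer (auto simp: fun_eq_iff cscale_cscale cscale_minus_one)
  fix f :: "nat \<Rightarrow> 'm clin"
  assume f: "\<And>n. f n \<in> Adj" and c: "\<forall>e>0. \<exists>M. \<forall>m\<ge>M. \<forall>n\<ge>M. opn (f m - f n) < e"
  show "\<exists>x\<in>Adj. (\<lambda>n. opn (f n - x)) \<longlonglongrightarrow> 0"
  proof (rule Adj_complete[OF f _ c])
    fix m n
    show "f m - f n \<in> Adj" using diff f by blast
    show "star (f m) - star (f n) \<in> Adj" using diff star_Adj f by blast
    show "opn (star (f m) - star (f n)) \<le> opn (f m - f n)"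
      using diff[OF f f] opn_star[of "f m - f n"] by simp
  qed
qed

section \<open>Evaluation of the definite descriptions\<close>

lemma app_adjointable:
  assumes "adjointable ip T" obtains a where "a \<in> Adj" "T = app a"
  using assms adjointable_clin[OF assms] by (metis Adj_def mem_Collect_eq)

text \<open>The forward direction is \<open>pos_st_mult\<close>; conversely a self-adjoint root
  serves as \<open>R\<close>.\<close>

lemma op_pos_iff: "op_pos ip T \<longleftrightarrow> (\<exists>a. L.pos a \<and> T = app a)"
proof
  assume "op_pos ip T"
  then obtain R where R: "adjointable ip R" "T = adj ip R \<circ> R" by (auto simp: op_pos_def)
  then obtain r where "r \<in> Adj" "R = app r" using app_adjointable by blast
  with R show "\<exists>a. L.pos a \<and> T = app a"
    using L.pos_st_mult[of r] by (intro exI[of _ "star r * r"]) (simp add: app_simps app_star)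
next
  assume "\<exists>a. L.pos a \<and> T = app a"
  then obtain h where "h \<in> Adj" "star h = h" "T = app (h * h)" by (auto simp: L.pos_def)
  then show "op_pos ip T"
    unfolding op_pos_def using app_star[of h]
    by (intro exI[of _ "app h"]) (auto simp: app_simps Adj_def)
qed

lemma op_abs_app:
  assumes a: "a \<in> Adj" and s: "L.pos s" "s * s = star a * a"
  shows "op_abs ip (app a) = app s"
  unfolding op_abs_def
proof (rule the_equality)
  show "op_pos ip (app s) \<and> app s \<circ> app s = adj ip (app a) \<circ> app a"
    using s a op_pos_iff by (auto simp flip: app_star times_clin.rep_eq)
next
  fix S assume "op_pos ip S \<and> S \<circ> S = adj ip (app a) \<circ> app a"
  then obtain b where b: "L.pos b" "S = app b" "app (b * b) = app (star a * a)"
    using a by (auto simp: op_pos_iff app_simps app_star)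
  then have "b * b = s * s" using s by (simp add: app_inject)
  then show "S = app s" using L.pos_sqrt_unique b s by blast
qed

lemma mp_inv_app:
  assumes "a \<in> Adj" "x \<in> Adj" "a * x * a = a" "x * a * x = x"
    "star (a * x) = a * x" "star (x * a) = x * a"
  shows "mp_inv ip (app a) = app x"
  unfolding mp_inv_def
proof (rule the_equality)
  have mp_iff: "adjointable ip (app y) \<and> app a \<circ> app y \<circ> app a = app a \<and> app y \<circ> app a \<circ> app y = app y
      \<and> adj ip (app a \<circ> app y) = app a \<circ> app y \<and> adj ip (app y \<circ> app a) = app y \<circ> app a
    \<longleftrightarrow> y \<in> Adj \<and> a * y * a = a \<and> y * a * y = y \<and> star (a * y) = a * y \<and> star (y * a) = y * a" for y
  proof (cases "y \<in> Adj")
    case True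
    then show ?thesis using assms(1)
      by (simp add: app_inject flip: times_clin.rep_eq app_star) (simp add: Adj_def)
  qed (simp add: Adj_def)
  show "adjointable ip (app x) \<and> app a \<circ> app x \<circ> app a = app a \<and> app x \<circ> app a \<circ> app x = app x
      \<and> adj ip (app a \<circ> app x) = app a \<circ> app x \<and> adj ip (app x \<circ> app a) = app x \<circ> app a"
    unfolding mp_iff using assms by blast
  fix X assume X: "adjointable ip X \<and> app a \<circ> X \<circ> app a = app a \<and> X \<circ> app a \<circ> X = X
      \<and> adj ip (app a \<circ> X) = app a \<circ> X \<and> adj ip (X \<circ> app a) = X \<circ> app a"
  then obtain y where "X = app y" using app_adjointable by blast
  with X mp_iff[of y] show "X = app x" using L.mp_inverse_unique[of a y x] assms by simp
qed

lemma op_inv_app: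
  assumes "x \<in> Adj" "x * a = 1" "a * x = 1"
  shows "op_inv ip (app a) = app x"
  unfolding op_inv_def
proof (rule the_equality)
  show "adjointable ip (app x) \<and> app x \<circ> app a = id \<and> app a \<circ> app x = id"
    using assms by (simp add: Adj_def flip: times_clin.rep_eq one_clin.rep_eq)
  fix X assume "adjointable ip X \<and> X \<circ> app a = id \<and> app a \<circ> X = id"
  moreover have "app a \<circ> app x = id" using assms(3) by (simp flip: times_clin.rep_eq one_clin.rep_eq)
  ultimately show "X = app x" by (metis comp_assoc comp_id id_comp)
qed

text \<open>For uniqueness, self-adjoint idempotents with equal range absorb each other, and taking
  the adjoint of \<open>r * p = p\<close> identifies them.\<close>

lemma range_proj_app:
  assumes p: "p \<in> Adj" "star p = p" "p * p = p" and q: "p * q = q" "q * p = p"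
  shows "range_proj ip (app q) = app p"
  unfolding range_proj_def
proof (rule the_equality)
  have "app p x = app q (app p x)" "app q x = app p (app q x)" for x
    using q by (metis times_clin.rep_eq comp_apply)+
  then have range_pq: "range (app p) = range (app q)" by blast
  then show "adjointable ip (app p) \<and> app p \<circ> app p = app p \<and> adj ip (app p) = app p \<and> range (app p) = range (app q)"
    using p by (simp flip: times_clin.rep_eq app_star) (simp add: Adj_def)
  fix P assume P: "adjointable ip P \<and> P \<circ> P = P \<and> adj ip P = P \<and> range P = range (app q)"
  then obtain r where r: "r \<in> Adj" "P = app r" using app_adjointable by blast
  have rr: "r * r = r" "star r = r"
    using P r by (simp_all add: app_inject flip: times_clin.rep_eq app_star)
  have ran: "range (app r) = range (app p)" using P r range_pq by simp
  have fix_range: "app b (app c x) = app c x" if idem: "b * b = b" and ran: "range (app b) = range (app c)" for b c x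
  proof -
    obtain y where "app c x = app b y" using ran by blast
    moreover have "app b (app b y) = app b y" using idem by (metis times_clin.rep_eq comp_apply)
    ultimately show ?thesis by simp
  qed
  have "r * p = p" "p * r = r"
    using fix_range[of r p] fix_range[of p r] ran rr p
    by (auto simp: app_inject[symmetric] app_simps fun_eq_iff)
  then have "r = p" using L.st_mult[of r p] r p rr by simp
  then show "P = app p" using r by simp
qed

lemma matched_proj_app:
  assumes "a \<in> Adj" "L.pos s" "s * s = a * star a"
    and "x \<in> Adj" "s * x * s = s" "x * s * x = x" "star (s * x) = s * x" "star (x * s) = x * s"
    and "e \<in> Adj" "e * (s + 1) = 1" "(s + 1) * e = 1"
  shows "matched_proj ip (app a) = app ((1/2) *\<^sub>R ((s + star a) * x * e * (s + a)))"
proof -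
  have s: "s \<in> Adj" using assms L.pos_closed by blast
  have "op_abs ip (adj ip (app a)) = app s"
    using op_abs_app[of "star a" s] assms by (simp add: app_star)
  moreover have "mp_inv ip (app s) = app x" using mp_inv_app s assms by blast
  moreover have "op_inv ip (op_add (app s) id) = app e"
    using op_inv_app[of e "s + 1"] assms by (simp add: app_simps)
  ultimately show ?thesis
    using assms(1) by (simp add: matched_proj_def Let_def app_simps app_star comp_assoc)
qed

theorem supp_proj_formula:
  assumes "adjointable ip Q" "Q \<circ> Q = Q"
  shows "supp_proj ip Q =
           op_add (op_add (matched_proj ip Q)
                     (op_diff id (adj ip Q) \<circ> mp_inv ip (op_abs ip (adj ip Q))))
                  (mp_inv ip (op_abs ip (adj ip Q)) \<circ> op_diff id Q)"
proof -
  obtain q where q: "q \<in> Adj" "Q = app q" using assms(1) by (rule app_adjointable)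
  have qq: "q * q = q" using assms(2) q by (simp add: app_inject flip: times_clin.rep_eq)
  obtain p where p: "p \<in> Adj" "star p = p" "p * p = p" "p * q = q" "q * p = p"
    using L.range_projection q(1) qq by blast
  obtain s e x where s: "L.pos s" "s * s = q * star q" "s * s = (2 *\<^sub>R p - q) * star (2 *\<^sub>R p - q)"
    and e: "e \<in> Adj" "e * (s + 1) = 1" "(s + 1) * e = 1"
    and x: "x \<in> Adj" "s * x * s = s" "x * s * x = x" "star (s * x) = s * x" "star (x * s) = x * s"
    and eq: "(1/2) *\<^sub>R ((s + star (2 *\<^sub>R p - q)) * x * e * (s + (2 *\<^sub>R p - q)))
      = (1/2) *\<^sub>R ((s + star q) * x * e * (s + q)) + (1 - star q) * x + x * (1 - q)"
    using L.idempotent_matched[OF q(1) qq p] by blast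
  have "supp_proj ip Q = matched_proj ip (app (2 *\<^sub>R p - q))"
    using range_proj_app[OF p] by (simp add: supp_proj_def q(2) app_simps)
  also have "\<dots> = app ((1/2) *\<^sub>R ((s + star (2 *\<^sub>R p - q)) * x * e * (s + (2 *\<^sub>R p - q))))"
    using p q by (intro matched_proj_app s x e) simp
  finally have "supp_proj ip Q
      = app ((1/2) *\<^sub>R ((s + star q) * x * e * (s + q)) + (1 - star q) * x + x * (1 - q))"
    unfolding eq .
  moreover have "matched_proj ip Q = app ((1/2) *\<^sub>R ((s + star q) * x * e * (s + q)))"
    unfolding q(2) by (intro matched_proj_app s x e q)
  moreover have "op_abs ip (adj ip Q) = app s"
    using op_abs_app[of "star q" s] q s by (simp add: app_star)
  moreover have "mp_inv ip (app s) = app x" using mp_inv_app L.pos_closed s x by blast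
  ultimately show ?thesis using q by (simp add: app_simps app_star)
qed

end

section \<open>The coefficient algebra and Cauchy-Schwarz for modules\<close>

text \<open>A C*-algebra is a complete inner product module over itself, for which the Cauchy--Schwarz
  inequality is just submultiplicativity of the norm.  Left multiplication then embeds it into a
  unital C*-algebra, from which it inherits the order properties needed for general modules.\<close>

lemma hmod_norm_self [simp]: "hmod_norm (\<lambda>x y. cstar x * y) x = norm (x::'a::cstar_algebra)"
  by (simp add: hmod_norm_def cstar_identity)

interpretation self: complete_inner "\<lambda>x y :: 'a::cstar_algebra. cstar x * y"
proof
  fix x y z :: 'a and c
  show "cstar x * (y + z) = cstar x * y + cstar x * z" by (rule distrib_left)
  show "cstar x * cscale c y = cscale c (cstar x * y)" by (rule cscale_mult_right[symmetric])
  show "cstar y * x = cstar (cstar x * y)" by (simp add: cstar_mult cstar_cstar)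
  show "x = 0" if "cstar x * x = 0" using cstar_identity[of x] that by simp
  show "norm (cstar x * y) \<le> hmod_norm (\<lambda>x y. cstar x * y) x * hmod_norm (\<lambda>x y. cstar x * y) y"
    using norm_mult_ineq[of "cstar x" y] by simp
  fix f :: "nat \<Rightarrow> 'a"
  assume "\<forall>e>0. \<exists>M. \<forall>m\<ge>M. \<forall>n\<ge>M. hmod_norm (\<lambda>x y. cstar x * y) (f m - f n) < e"
  then have "Cauchy f" by (simp add: Cauchy_def dist_norm)
  then obtain l where "f \<longlonglongrightarrow> l" using Cauchy_convergent convergent_def by blast
  then show "\<exists>x. (\<lambda>n. hmod_norm (\<lambda>x y. cstar x * y) (f n - x)) \<longlonglongrightarrow> 0"
    by (auto intro!: exI[of _ l] tendsto_norm_zero simp: LIM_zero_iff)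
qed

lift_definition lmul :: "'a::cstar_algebra \<Rightarrow> 'a clin" is "(*)"
  by (simp add: distrib_left cscale_mult_right)

lemma lmul_add: "lmul (a + b) = lmul a + lmul b"
  and lmul_diff: "lmul (a - b) = lmul a - lmul b"
  and lmul_mult: "lmul (a * b) = lmul a * lmul b"
  and lmul_scaleR: "lmul (r *\<^sub>R a) = r *\<^sub>R lmul a"
  by (simp_all add: app_inject[symmetric] lmul.rep_eq app_simps op_add_def op_diff_def op_scale_def
      fun_eq_iff algebra_simps)

lemma lmul_Adj [simp]: "lmul a \<in> self.Adj"
  and star_lmul [simp]: "self.star (lmul a) = lmul (cstar a)"
  by (rule self.AdjI[of _ "lmul (cstar a)"] self.star_eqI, simp add: lmul.rep_eq cstar_mult mult.assoc)+

text \<open>Testing on \<open>cstar a\<close> attains the norm. Isometry lets norm comparisons made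
  among operators return to the algebra.\<close>

lemma opn_lmul [simp]: "self.opn (lmul a) = norm a"
proof (rule antisym)
  show "self.opn (lmul a) \<le> norm a"
    by (rule self.opn_le) (auto simp: lmul.rep_eq norm_mult_ineq)
  have "norm a * norm a \<le> self.opn (lmul a) * norm a"
    using self.opn_bound[OF lmul_Adj, of a "cstar a"] cstar_identity[of "cstar a"]
    by (simp add: lmul.rep_eq power2_eq_square cstar_cstar)
  then show "norm a \<le> self.opn (lmul a)"
    by (cases "a = 0") (auto simp: self.opn_nonneg)
qed

lemma pos_lmul: "cpos a \<Longrightarrow> self.L.pos (lmul a)"
  using self.L.pos_st_mult[OF lmul_Adj] by (auto simp: cpos_def lmul_mult)

text \<open>Positivity of the square of \<open>act x a - n y\<close>, together with
  \<open>cstar a * ip x x * a \<le> n cstar a * a\<close>, gives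
  \<open>n cstar a * a \<le> n n ip y y\<close>; then norms are compared.\<close>

lemma hilbert_module_cauchy_schwarz:
  assumes "sesquilinear_definite ip"
    and act: "\<And>x y a. ip x (act y a) = ip x y * a" and pos: "\<And>x. cpos (ip x x)"
  shows "norm (ip x y) \<le> hmod_norm ip x * hmod_norm ip y"
proof -
  interpret sesquilinear_definite ip by fact
  define n where "n = norm (ip x x)"
  define a where "a = ip x y"
  show ?thesis
  proof (cases "x = 0")
    case True
    then show ?thesis using ip_scaleR_left[of 0 x y] by simp
  next
    case False
    then have n: "0 < n" using ip_definite[of x] by (auto simp: n_def)
    define d where "d = cstar a * ip x x * a"
    have act_left: "ip (act x a) z = cstar a * ip x z" for z
      by (metis act ip_sym cstar_mult cstar_cstar)
    have ya: "ip y x = cstar a" by (metis a_def ip_sym)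
    have "ip (act x a - n *\<^sub>R y) (act x a - n *\<^sub>R y)
        = d - n *\<^sub>R (cstar a * a) - n *\<^sub>R (cstar a * a) + (n * n) *\<^sub>R ip y y"
      by (simp add: ip_diff_left ip_diff_right ip_scaleR_left ip_scaleR_right act act_left ya
          scaleR_diff_right left_diff_distrib d_def mult.assoc flip: a_def)
    then have "self.L.pos (lmul (d - n *\<^sub>R (cstar a * a) - n *\<^sub>R (cstar a * a) + (n * n) *\<^sub>R ip y y))"
      using pos_lmul pos by metis
    moreover have "self.L.pos (lmul (n *\<^sub>R (cstar a * a) - d))"
    proof -
      \<comment> \<open>Here \<open>1\<close> is the identity operator, as the algebra has no
        distinguished unit. Conjugating by \<open>lmul a\<close> leads back into the image of
        \<open>lmul\<close>.\<close>
      have "self.L.pos (n *\<^sub>R 1 - lmul (ip x x))"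
        using n by (intro self.L.pos_scalar_minus) (auto simp: n_def ip_sym[of x x, symmetric])
      then obtain k where k: "k \<in> self.Adj" "self.star k = k" "n *\<^sub>R 1 - lmul (ip x x) = k * k"
        by (auto simp: self.L.pos_def)
      have "lmul (n *\<^sub>R (cstar a * a) - d) = lmul (cstar a) * (n *\<^sub>R 1 - lmul (ip x x)) * lmul a"
        by (simp add: lmul_diff lmul_mult lmul_scaleR d_def algebra_simps)
      also have "\<dots> = self.star (k * lmul a) * (k * lmul a)"
        unfolding k(3) using k by (simp add: mult.assoc)
      finally show ?thesis
        using self.L.pos_st_mult[OF self.L.mult_closed[OF k(1) lmul_Adj]] by (simp only:)
    qed
    ultimately have "self.L.pos (lmul (d - n *\<^sub>R (cstar a * a) - n *\<^sub>R (cstar a * a) + (n * n) *\<^sub>R ip y y)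
        + lmul (n *\<^sub>R (cstar a * a) - d))"
      by (rule self.L.pos_add)
    then have 1: "self.L.pos (lmul ((n * n) *\<^sub>R ip y y - n *\<^sub>R (cstar a * a)))"
      by (simp flip: lmul_add)
    have 2: "self.L.pos (lmul (n *\<^sub>R (cstar a * a)))"
      using self.L.pos_scaleR[OF pos_lmul[of "cstar a * a"], of n] n by (auto simp: cpos_def lmul_scaleR)
    have "norm (n *\<^sub>R (cstar a * a)) \<le> norm ((n * n) *\<^sub>R ip y y)"
      using self.L.pos_nrm_mono[OF 2 1] by (simp flip: lmul_add)
    then have "(norm a)\<^sup>2 \<le> n * norm (ip y y)" using n by (simp add: cstar_identity)
    then have "norm a \<le> sqrt (n * norm (ip y y))" by (rule real_le_rsqrt)
    then show ?thesis by (simp add: a_def n_def hmod_norm_def real_sqrt_mult)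
  qed
qed

theorem theorem5p3:
  fixes ip :: "'m::complex_vs \<Rightarrow> 'm \<Rightarrow> 'a::cstar_algebra"
    and act :: "'m \<Rightarrow> 'a \<Rightarrow> 'm"
    and Q :: "'m \<Rightarrow> 'm"
  assumes "hilbert_cstar_module ip act"
    and "adjointable ip Q"
    and "Q \<circ> Q = Q"
  shows "supp_proj ip Q =
           op_add (op_add (matched_proj ip Q)
                     (op_diff id (adj ip Q) \<circ> mp_inv ip (op_abs ip (adj ip Q))))
                  (mp_inv ip (op_abs ip (adj ip Q)) \<circ> op_diff id Q)"
proof -
  have ax: "\<forall>x y z. ip x (y + z) = ip x y + ip x z" "\<forall>c x y. ip x (cscale c y) = cscale c (ip x y)"
    "\<forall>x y a. ip x (act y a) = ip x y * a" "\<forall>x y. ip y x = cstar (ip x y)"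
    "\<forall>x. cpos (ip x x)" "\<forall>x. ip x x = 0 \<longrightarrow> x = 0"
    "\<forall>f :: nat \<Rightarrow> 'm. (\<forall>e>0. \<exists>N. \<forall>m\<ge>N. \<forall>n\<ge>N. hmod_norm ip (f m - f n) < e) \<longrightarrow>
        (\<exists>x. (\<lambda>n. hmod_norm ip (f n - x)) \<longlonglongrightarrow> 0)"
    using assms(1) unfolding hilbert_cstar_module_def by - (elim conjE, assumption)+
  have sesq: "sesquilinear_definite ip"
    by (intro sesquilinear_definite.intro) (rule ax[rule_format], assumption?)+
  have "complete_inner ip"
    by (intro complete_inner.intro complete_inner_axioms.intro sesq ax(7)[THEN spec, THEN mp]
        hilbert_module_cauchy_schwarz[OF sesq, of act] ax(3)[rule_format] ax(5)[rule_format])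
  then show ?thesis using assms(2,3) by (rule complete_inner.supp_proj_formula)
qed

end
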